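(* Let $P$ be a finite set with partial orders $<$ and $<'$ such that $<'$ is weaker than $<$ and $\mathcal J=\mathcal J(P,<)$ is closed under $*_{P,<'}$. For any $w\in\overline{C(I_{P,<,<'},I^m_{P,<})}\subset\mathbb R^{\mathcal J}$, all irreducible components of the zero set of $\mathrm{in}_wI_{P,<,<'}$ in $\mathbb P(\mathbb C^{\mathcal J})$ have the form $H(P,<'',<')$ for some partial order $<''$ on $P$ stronger than $<$. Here $H(P,<'',<')\subset\mathbb P(\mathbb C^{\mathcal J(P,<'')})$ is embedded into $\mathbb P(\mathbb C^{\mathcal J})$ via the inclusion $\mathcal J(P,<'')\subset\mathcal J$.
   Context: An order ideal is a lower set; $\mathcal J(P,<)$ is the set of order ideals of $(P,<)$. An order $<'$ is weaker than $<$ (and $<$ stronger than $<'$) if $p<'q$ implies $p<q$ (equality allowed). $\max_<A$ is the set of $<$-maximal elements of $A\subset P$. For $J_1,J_2\in\mathcal J(P,<')$, $J_1*_{P,<'}J_2$ is the order ideal of $(P,<')$ generated by $(J_1\cap J_2)\cap(\max_{<'}J_1\cup\max_{<'}J_2)$. $\mathbb C[\mathcal J(P,<)]$ is the polynomial ring in variables $X_J$, $J\in\mathcal J(P,<)$, the homogeneous coordinate ring of $\mathbb P(\mathbb C^{\mathcal J(P,<)})$. When $<'$ is weaker than $<$ and $\mathcal J(P,<)$ is closed under $*_{P,<'}$, the relative Hibi ideal $I_{P,<,<'}$ is the kernel of $\mathbb C[\mathcal J(P,<)]\to\mathbb C[\{z_p\}_{p\in P},t]$, $X_J\mapsto t\prod_{p\in\max_{<'}J}z_p$,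 and the relative Hibi variety $H(P,<,<')\subset\mathbb P(\mathbb C^{\mathcal J(P,<)})$ is its zero set. (The notation $H(P,<'',<')$ includes that $\mathcal J(P,<'')$ is closed under $*_{P,<'}$.) $I^m_{P,<}$ is the monomial ideal generated by the $X_{J_1}X_{J_2}$ with $J_1,J_2\in\mathcal J(P,<)$ incomparable under inclusion. For $w\in\mathbb R^N$ and $I\subset\mathbb C[X_1,\dots,X_N]$, $\mathrm{in}_wp$ is the sum of the terms of $p$ of minimal $w$-weight and $\mathrm{in}_wI$ is the span of $\{\mathrm{in}_wp:p\in I\}$. $C(I,I')=\{w\in\mathbb R^N:\mathrm{in}_wI=I'\}$, and the bar denotes closure. *)

theory Defs
  imports "HOL-Analysis.Analysis" "HOL-Library.Poly_Mapping"
begin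

section \<open>Orders and order ideals\<close>

text \<open>
  A partial order on \<open>P\<close> is given by its reflexive relation, \<open>partial_order_on P r\<close>; this includes
  \<open>r \<subseteq> P \<times> P\<close>. For two reflexive relations on the same set \<open>P\<close>, inclusion is the same as
  inclusion of their strict parts, so the following is the usual notion of a weaker order,
  equality allowed.
\<close>

definition weaker_order :: "'p rel \<Rightarrow> 'p rel \<Rightarrow> bool" where
  "weaker_order r' r \<longleftrightarrow> (\<forall>p q. (p, q) \<in> r' \<longrightarrow> (p, q) \<in> r)"

definition order_ideals :: "'p set \<Rightarrow> 'p rel \<Rightarrow> 'p set set" where
  "order_ideals P r = {J. J \<subseteq> P \<and> (\<forall>q\<in>J. \<forall>p\<in>P. (p, q) \<in> r \<longrightarrow> p \<in> J)}"

definition max_elements :: "'p rel \<Rightarrow> 'p set \<Rightarrow> 'p set" where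
  "max_elements r A = {a \<in> A. \<forall>b\<in>A. (a, b) \<in> r \<longrightarrow> b = a}"

definition star :: "'p set \<Rightarrow> 'p rel \<Rightarrow> 'p set \<Rightarrow> 'p set \<Rightarrow> 'p set" where
  "star P r' J1 J2 =
     (\<lambda>J. J \<in> order_ideals P r') hull
       ((J1 \<inter> J2) \<inter> (max_elements r' J1 \<union> max_elements r' J2))"

definition star_closed :: "'p set \<Rightarrow> 'p rel \<Rightarrow> 'p set set \<Rightarrow> bool" where
  "star_closed P r' \<J> \<longleftrightarrow> (\<forall>J1\<in>\<J>. \<forall>J2\<in>\<J>. star P r' J1 J2 \<in> \<J>)"

section \<open>Complex polynomials\<close>

text \<open>
  A polynomial maps each monomial (a finitely supported exponent vector) to its coefficient;
  multiplication is the convolution product. The polynomial ring in the variables indexed by a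
  set \<open>V\<close> is the subring \<open>polys V\<close>.
\<close>

type_synonym 'v cpoly = "('v \<Rightarrow>\<^sub>0 nat) \<Rightarrow>\<^sub>0 complex"

definition polys :: "'v set \<Rightarrow> 'v cpoly set" where
  "polys V = {f. \<forall>m\<in>Poly_Mapping.keys f. Poly_Mapping.keys m \<subseteq> V}"

definition const :: "complex \<Rightarrow> 'v cpoly" where
  "const c = Poly_Mapping.single 0 c"

definition var :: "'v \<Rightarrow> 'v cpoly" where
  "var v = Poly_Mapping.single (Poly_Mapping.single v 1) 1"

definition cscale :: "complex \<Rightarrow> 'v cpoly \<Rightarrow> 'v cpoly" where
  "cscale c f = const c * f"

global_interpretation cpoly: vector_space cscale
  by unfold_locales
    (simp_all add: cscale_def const_def algebra_simps single_add mult_single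
      flip: mult.assoc)

text \<open>
  \<open>poly_hom \<phi> g\<close> is the ring homomorphism that is \<open>\<phi>\<close> on the coefficients and sends the variable
  with index \<open>v\<close> to \<open>g v\<close>.
\<close>

definition poly_hom :: "(complex \<Rightarrow> 'r) \<Rightarrow> ('v \<Rightarrow> 'r) \<Rightarrow> 'v cpoly \<Rightarrow> 'r::comm_ring_1" where
  "poly_hom \<phi> g f =
     (\<Sum>m\<in>Poly_Mapping.keys f. \<phi> (Poly_Mapping.lookup f m) *
        (\<Prod>v\<in>Poly_Mapping.keys m. g v ^ Poly_Mapping.lookup m v))"

definition eval :: "('v \<Rightarrow> complex) \<Rightarrow> 'v cpoly \<Rightarrow> complex" where
  "eval x f = poly_hom (\<lambda>c. c) x f"

definition homogeneous :: "'v cpoly \<Rightarrow> bool" where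
  "homogeneous f \<longleftrightarrow>
     (\<exists>d. \<forall>m\<in>Poly_Mapping.keys f. (\<Sum>v\<in>Poly_Mapping.keys m. Poly_Mapping.lookup m v) = d)"

text \<open>The ideal of the ring \<open>polys V\<close> (not of the ring of all polynomials) generated by \<open>G\<close>.\<close>

definition ideal_generated :: "'v set \<Rightarrow> 'v cpoly set \<Rightarrow> 'v cpoly set" where
  "ideal_generated V G =
     {(\<Sum>g\<in>T. a g * g) | T a. finite T \<and> T \<subseteq> G \<and> (\<forall>g\<in>T. a g \<in> polys V)}"

section \<open>Initial ideals\<close>

definition weight :: "('v \<Rightarrow> real) \<Rightarrow> ('v \<Rightarrow>\<^sub>0 nat) \<Rightarrow> real" where
  "weight w m = (\<Sum>v\<in>Poly_Mapping.keys m. w v * real (Poly_Mapping.lookup m v))"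

definition initial_form :: "('v \<Rightarrow> real) \<Rightarrow> 'v cpoly \<Rightarrow> 'v cpoly" where
  "initial_form w f =
     (\<Sum>m | m \<in> Poly_Mapping.keys f \<and> (\<forall>m'\<in>Poly_Mapping.keys f. weight w m \<le> weight w m').
        Poly_Mapping.single m (Poly_Mapping.lookup f m))"

definition initial_ideal :: "('v \<Rightarrow> real) \<Rightarrow> 'v cpoly set \<Rightarrow> 'v cpoly set" where
  "initial_ideal w I = cpoly.span (initial_form w ` I)"

text \<open>
  The coordinate spaces \<open>\<real>\<^sup>V\<close> and \<open>\<complex>\<^sup>V\<close> consist of the functions on the ambient type that vanish
  outside \<open>V\<close>. For finite \<open>V\<close> the product topology on functions induces on \<open>\<real>\<^sup>V\<close> the Euclidean
  topology, and \<open>\<real>\<^sup>V\<close> is closed, so the library's \<open>closure\<close> of a subset of \<open>\<real>\<^sup>V\<close> is its closure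
  in \<open>\<real>\<^sup>V\<close>.
\<close>

definition coord_space :: "'v set \<Rightarrow> ('v \<Rightarrow> 'a::zero) set" where
  "coord_space V = {x. \<forall>v. v \<notin> V \<longrightarrow> x v = 0}"

definition initial_cone :: "'v set \<Rightarrow> 'v cpoly set \<Rightarrow> 'v cpoly set \<Rightarrow> ('v \<Rightarrow> real) set" where
  "initial_cone V I I' = {w \<in> coord_space V. initial_ideal w I = I'}"

section \<open>Projective space and the Zariski topology\<close>

text \<open>
  A point of \<open>\<P>(\<complex>\<^sup>V)\<close> is the set of nonzero multiples of a nonzero vector in \<open>\<complex>\<^sup>V\<close>. As vectors are
  extended by zero, \<open>U \<subseteq> V\<close> implies \<open>proj_space U \<subseteq> proj_space V\<close>, and this inclusion is the
  standard embedding of \<open>\<P>(\<complex>\<^sup>U)\<close> as a coordinate subspace of \<open>\<P>(\<complex>\<^sup>V)\<close>.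
\<close>

definition proj_point :: "('v \<Rightarrow> complex) \<Rightarrow> ('v \<Rightarrow> complex) set" where
  "proj_point x = {(\<lambda>v. c * x v) | c. c \<noteq> 0}"

definition proj_space :: "'v set \<Rightarrow> ('v \<Rightarrow> complex) set set" where
  "proj_space V = {proj_point x | x. x \<in> coord_space V \<and> x \<noteq> (\<lambda>v. 0)}"

definition zero_set :: "'v set \<Rightarrow> 'v cpoly set \<Rightarrow> ('v \<Rightarrow> complex) set set" where
  "zero_set V S = {l \<in> proj_space V. \<forall>x\<in>l. \<forall>f\<in>S. eval x f = 0}"

definition zariski_closed :: "'v set \<Rightarrow> ('v \<Rightarrow> complex) set set \<Rightarrow> bool" where
  "zariski_closed V Z \<longleftrightarrow>
     (\<exists>S. S \<subseteq> polys V \<and> (\<forall>f\<in>S. homogeneous f) \<and> Z = zero_set V S)"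

definition irreducible_subset :: "'v set \<Rightarrow> ('v \<Rightarrow> complex) set set \<Rightarrow> bool" where
  "irreducible_subset V Y \<longleftrightarrow>
     Y \<subseteq> proj_space V \<and> Y \<noteq> {} \<and>
     (\<forall>A B. zariski_closed V A \<and> zariski_closed V B \<and> Y \<subseteq> A \<union> B \<longrightarrow> Y \<subseteq> A \<or> Y \<subseteq> B)"

definition irreducible_component ::
    "'v set \<Rightarrow> ('v \<Rightarrow> complex) set set \<Rightarrow> ('v \<Rightarrow> complex) set set \<Rightarrow> bool" where
  "irreducible_component V Z Y \<longleftrightarrow>
     irreducible_subset V Y \<and> Y \<subseteq> Z \<and>
     (\<forall>Y'. irreducible_subset V Y' \<and> Y \<subseteq> Y' \<and> Y' \<subseteq> Z \<longrightarrow> Y' = Y)"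

section \<open>Relative Hibi ideals and varieties\<close>

datatype 'p hibi_var = T | Z 'p

definition hibi_hom :: "'p rel \<Rightarrow> 'p set cpoly \<Rightarrow> 'p hibi_var cpoly" where
  "hibi_hom r' = poly_hom const (\<lambda>J. var T * (\<Prod>p\<in>max_elements r' J. var (Z p)))"

definition relative_hibi_ideal :: "'p set \<Rightarrow> 'p rel \<Rightarrow> 'p rel \<Rightarrow> 'p set cpoly set" where
  "relative_hibi_ideal P r r' = {f \<in> polys (order_ideals P r). hibi_hom r' f = 0}"

definition relative_hibi_variety ::
    "'p set \<Rightarrow> 'p rel \<Rightarrow> 'p rel \<Rightarrow> ('p set \<Rightarrow> complex) set set" where
  "relative_hibi_variety P r r' = zero_set (order_ideals P r) (relative_hibi_ideal P r r')"

definition monomial_hibi_ideal :: "'p set \<Rightarrow> 'p rel \<Rightarrow> 'p set cpoly set" where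
  "monomial_hibi_ideal P r =
     ideal_generated (order_ideals P r)
       {var J1 * var J2 | J1 J2.
          J1 \<in> order_ideals P r \<and> J2 \<in> order_ideals P r \<and> \<not> J1 \<subseteq> J2 \<and> \<not> J2 \<subseteq> J1}"

end

theory Submission
  imports Defs "HOL-Computational_Algebra.Polynomial"
begin

text \<open>
  For \<open>J1, J2\<close> in \<open>\<J>\<close> the binomial \<open>X\<^sub>J\<^sub>1 X\<^sub>J\<^sub>2 - X\<^sub>U X\<^sub>S\<close> with \<open>U = J1 \<union> J2\<close> and
  \<open>S = J1 * J2\<close> lies in the relative Hibi ideal, so every \<open>w\<close> in the closed cone satisfies
  \<open>w(J1) + w(J2) \<le> w(U) + w(S)\<close>, and nothing else about \<open>w\<close> is needed.

  A linear extension of \<open><\<close> (a maximal chain, or flag, in \<open>\<J>\<close>) determines a function \<open>L\<close> on \<open>\<J>\<close>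
  that is affine in the exponents of the monomials \<open>t \<Prod>z\<^sub>p\<close> and equals \<open>w\<close> on the flag. The
  inequality gives \<open>w \<le> L\<close> on all of \<open>\<J>\<close>, and the tight ideals (where \<open>w = L\<close>) form a family
  closed under \<open>\<union>\<close>, \<open>*\<close> and \<open>\<inter>\<close>, hence the family of order ideals of some \<open><''\<close>.

  The variety \<open>H\<close> of a tight family is cut out by the quadrics above, because multiplying out from
  the left replaces any product by one whose first factor is the union of all ideals involved, which
  is determined by the exponent. It lies in the zero set of the initial ideal because \<open>w \<le> L\<close>, and
  it is irreducible because it is parametrized by monomials. Conversely the support of a point of
  this zero set is closed under \<open>\<union>\<close> and \<open>*\<close> with equality in the inequality above, so extending a
  maximal chain of the support to a flag yields a tight family containing the support. Thus the
  zero set is a finite union of the irreducible closed sets \<open>H\<close>.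
\<close>

section \<open>Monomials and evaluation\<close>

abbreviation "keys \<equiv> Poly_Mapping.keys"
abbreviation "lookup \<equiv> Poly_Mapping.lookup"
abbreviation "single \<equiv> Poly_Mapping.single"

text \<open>An exponent acts by repeated addition because values in a general commutative monoid are
  needed: reals for weights, naturals for degrees, exponent vectors for the toric map.\<close>

definition madd :: "('v \<Rightarrow> 'a::comm_monoid_add) \<Rightarrow> ('v \<Rightarrow>\<^sub>0 nat) \<Rightarrow> 'a" where
  "madd g m = (\<Sum>v\<in>keys m. \<Sum>i<lookup m v. g v)"

definition meval :: "('v \<Rightarrow> 'a::comm_monoid_mult) \<Rightarrow> ('v \<Rightarrow>\<^sub>0 nat) \<Rightarrow> 'a" where
  "meval y m = (\<Prod>v\<in>keys m. y v ^ lookup m v)"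

lemma madd_0 [simp]: "madd g 0 = 0"
  by (simp add: madd_def)

lemma madd_single [simp]: "madd g (single v 1) = g v"
  by (simp add: madd_def)

lemma sum_lessThan_const_add:
  fixes a :: "'a::comm_monoid_add"
  shows "(\<Sum>i<m + n. a) = (\<Sum>i<m. a) + (\<Sum>i<(n::nat). a)"
  by (induction n) (simp_all add: ac_simps)

lemma madd_supset:
  assumes "finite A" "keys m \<subseteq> A"
  shows "madd g m = (\<Sum>v\<in>A. \<Sum>i<lookup m v. g v)"
  unfolding madd_def using assms by (intro sum.mono_neutral_left) (auto simp: in_keys_iff)

lemma meval_supset:
  assumes "finite A" "keys m \<subseteq> A"
  shows "meval y m = (\<Prod>v\<in>A. y v ^ lookup m v)"
  unfolding meval_def using assms by (intro prod.mono_neutral_left) (auto simp: in_keys_iff)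

lemma madd_add [simp]: "madd g (m + n) = madd g m + madd g n"
proof -
  have "keys (m + n) \<subseteq> keys m \<union> keys n" by (rule Poly_Mapping.keys_add)
  then show ?thesis
    by (simp add: madd_supset[of "keys m \<union> keys n"] lookup_add sum_lessThan_const_add sum.distrib)
qed

lemma meval_0 [simp]: "meval g 0 = 1"
  by (simp add: meval_def)

lemma meval_single [simp]: "meval g (single v 1) = g v"
  by (simp add: meval_def)

lemma meval_add [simp]: "meval g (m + n) = meval g m * meval g n"
proof -
  have "keys (m + n) \<subseteq> keys m \<union> keys n" by (rule Poly_Mapping.keys_add)
  then show ?thesis
    by (simp add: meval_supset[of "keys m \<union> keys n"] lookup_add power_add prod.distrib)
qed

text \<open>Additive and multiplicative functions of a monomial can be treated one variable at a
  time. As \<open>update_induct\<close> sets a whole exponent at once, an inner induction raises it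
  in unit steps.\<close>

lemma monomial_induct [case_names zero add]:
  fixes m :: "'v \<Rightarrow>\<^sub>0 nat"
  assumes "Q 0" and step: "\<And>m v. Q m \<Longrightarrow> Q (m + single v 1)"
  shows "Q m"
proof (induction m rule: Poly_Mapping.update_induct)
  case const
  then show ?case by (rule assms(1))
next
  case (update f a b)
  have *: "Q (f + single a n)" for n
  proof (induction n)
    case 0
    then show ?case using update by simp
  next
    case (Suc n)
    have "f + single a (Suc n) = (f + single a n) + single a 1"
      by (simp add: add.assoc flip: single_add)
    then show ?case using step[OF Suc] by simp
  qed
  have "Poly_Mapping.update a b f = f + single a b"
    using update by (intro poly_mapping_eqI) (auto simp: lookup_update lookup_add lookup_single when_def in_keys_iff)
  then show ?case using * by simp
qed

text \<open>Together with \<open>meval_madd\<close> this pulls back a weight or a point along the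
  monomial map \<open>h\<close>.\<close>

lemma madd_madd: "madd g (madd h m) = madd (\<lambda>v. madd g (h v)) m"
  by (induction m rule: monomial_induct) (simp_all del: One_nat_def)

lemma meval_madd: "meval y (madd h m) = meval (\<lambda>v. meval y (h v)) m"
  by (induction m rule: monomial_induct) (simp_all del: One_nat_def)

lemma keys_monomial_add: "keys (m + n) = keys m \<union> keys (n :: 'v \<Rightarrow>\<^sub>0 nat)"
  by (auto simp: in_keys_iff lookup_add)

text \<open>The list repeats each variable according to its exponent, so that straightening can
  recurse over the factors of a monomial.\<close>

lemma monomial_as_list:
  fixes m :: "'v \<Rightarrow>\<^sub>0 nat" and y :: "'v \<Rightarrow> complex" and h :: "'v \<Rightarrow> 'b::comm_monoid_add"
  shows "\<exists>Ks. set Ks = keys m \<and> meval y m = prod_list (map y Ks) \<and> madd h m = sum_list (map h Ks)"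
proof (induction m rule: monomial_induct)
  case zero
  then show ?case by (intro exI[of _ "[]"]) simp
next
  case (add m v)
  then obtain Ks where "set Ks = keys m" "meval y m = prod_list (map y Ks)"
    "madd h m = sum_list (map h Ks)" by blast
  then show ?case
    by (intro exI[of _ "v # Ks"]) (simp add: keys_monomial_add ac_simps del: One_nat_def)
qed

lemma meval_cong: "(\<And>v. v \<in> keys m \<Longrightarrow> y v = z v) \<Longrightarrow> meval y m = meval z m"
  by (simp add: meval_def)

lemma meval_eq_0: 
  fixes y :: "'v \<Rightarrow> 'a::{comm_semiring_1, semiring_no_zero_divisors}"
  shows "v \<in> keys m \<Longrightarrow> y v = 0 \<Longrightarrow> meval y m = 0"
  unfolding meval_def by (intro prod_zero) (auto simp: in_keys_iff power_0_left intro!: bexI[of _ v])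

lemma madd_mono:
  fixes g h :: "'v \<Rightarrow> 'a::ordered_comm_monoid_add"
  shows "(\<And>v. v \<in> keys m \<Longrightarrow> g v \<le> h v) \<Longrightarrow> madd g m \<le> madd h m"
  by (auto simp: madd_def intro!: sum_mono)

lemma madd_cong: "(\<And>v. v \<in> keys m \<Longrightarrow> y v = z v) \<Longrightarrow> madd y m = madd z m"
  by (simp add: madd_def)

lemma madd_strict_mono:
  fixes g h :: "'v \<Rightarrow> real"
  assumes "\<And>v. v \<in> keys m \<Longrightarrow> g v \<le> h v" "v \<in> keys m" "g v < h v"
  shows "madd g m < madd h m"
  unfolding madd_def
proof (rule sum_strict_mono_ex1)
  show "\<forall>v\<in>keys m. (\<Sum>i<lookup m v. g v) \<le> (\<Sum>i<lookup m v. h v)"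
    using assms(1) by (intro ballI sum_mono)
  show "\<exists>v\<in>keys m. (\<Sum>i<lookup m v. g v) < (\<Sum>i<lookup m v. h v)"
    using assms(2,3) by (intro bexI[of _ v]) (auto simp: in_keys_iff)
qed simp

lemma weight_eq_madd: "weight w m = madd w m"
  by (simp add: weight_def madd_def mult.commute)

lemma madd_fun_upd:
  fixes g :: "'v \<Rightarrow> real"
  shows "madd (g(v := g v + d)) m = madd g m + d * real (lookup m v)"
  by (induction m rule: monomial_induct)
    (auto simp: lookup_add lookup_single when_def algebra_simps simp del: One_nat_def)

lemma eval_eq: "eval x f = (\<Sum>m\<in>keys f. lookup f m * meval x m)"
  by (simp add: eval_def poly_hom_def meval_def)

lemma eval_supset:
  assumes "finite A" "keys f \<subseteq> A"
  shows "eval x f = (\<Sum>m\<in>A. lookup f m * meval x m)"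
  unfolding eval_eq using assms by (intro sum.mono_neutral_left) (auto simp: in_keys_iff)

lemma eval_0 [simp]: "eval x 0 = 0"
  by (simp add: eval_eq)

lemma eval_add: "eval x (f + g) = eval x f + eval x g"
proof -
  have "keys (f + g) \<subseteq> keys f \<union> keys g" by (rule Poly_Mapping.keys_add)
  then show ?thesis
    by (simp add: eval_supset[of "keys f \<union> keys g"] lookup_add ring_distribs sum.distrib)
qed

lemma eval_diff: "eval x (f - g) = eval x f - eval x g"
  using eval_add[of x "f - g" g] by simp

lemma lookup_cscale: "lookup (cscale c f) m = c * lookup f m"
proof -
  have "cscale c f = (\<Sum>n\<in>keys f. single n (c * lookup f n))"
  proof -
    have "f = (\<Sum>n\<in>keys f. single n (lookup f n))"
      by (intro poly_mapping_eqI)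
        (auto simp: lookup_sum lookup_single when_def in_keys_iff)
    then have "cscale c f = const c * (\<Sum>n\<in>keys f. single n (lookup f n))"
      by (simp add: cscale_def)
    then show ?thesis by (simp add: const_def sum_distrib_left mult_single)
  qed
  then show ?thesis
    by (auto simp: lookup_sum lookup_single when_def in_keys_iff)
qed

lemma eval_cscale: "eval x (cscale c f) = c * eval x f"
proof -
  have "keys (cscale c f) \<subseteq> keys f" by (auto simp: in_keys_iff lookup_cscale)
  then show ?thesis
    by (simp add: eval_supset[of "keys f"] lookup_cscale sum_distrib_left mult.assoc)
qed

lemma eval_single: "eval x (single m c) = c * meval x m"
  by (simp add: eval_eq)

section \<open>Initial forms and sums over fibres\<close>

lemma initial_form_lookup:
  "lookup (initial_form w f) m =
     (if m \<in> keys f \<and> (\<forall>m'\<in>keys f. weight w m \<le> weight w m') then lookup f m else 0)"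
  by (auto simp: initial_form_def lookup_sum lookup_single when_def in_keys_iff)

lemma keys_initial_form:
  "keys (initial_form w f) = {m \<in> keys f. \<forall>m'\<in>keys f. weight w m \<le> weight w m'}"
  by (intro set_eqI) (simp add: in_keys_iff[of _ "initial_form w f"] initial_form_lookup, simp add: in_keys_iff)

text \<open>Evaluation at \<open>x\<close> is linear, so its kernel contains a span as soon as it
  contains the generators.\<close>

lemma eval_initial_ideal_iff:
  "(\<forall>f\<in>initial_ideal w I. eval x f = 0) \<longleftrightarrow> (\<forall>f\<in>I. eval x (initial_form w f) = 0)"
proof -
  have "cpoly.subspace {f. eval x f = 0}"
    by (auto simp: cpoly.subspace_def eval_add eval_cscale)
  then have "initial_form w ` I \<subseteq> {f. eval x f = 0} \<Longrightarrow> initial_ideal w I \<subseteq> {f. eval x f = 0}"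
    unfolding initial_ideal_def by (rule cpoly.span_minimal[rotated])
  moreover have "initial_form w ` I \<subseteq> initial_ideal w I"
    unfolding initial_ideal_def by (rule cpoly.span_superset)
  ultimately show ?thesis by blast
qed

text \<open>In the applications \<open>c\<close> gives coefficients of a polynomial,
  \<open>\<mu>\<close> is the exponent map and \<open>g\<close> evaluates monomials. Within a fibre
  \<open>g\<close> is a common factor, and the remaining sum of coefficients vanishes.\<close>

lemma sum_fibres_zero:
  fixes c g :: "'m \<Rightarrow> complex"
  assumes "finite K" "\<And>v. (\<Sum>m | m \<in> K \<and> \<mu> m = v. c m) = 0"
    and "\<And>m m'. m \<in> K \<Longrightarrow> m' \<in> K \<Longrightarrow> \<mu> m = \<mu> m' \<Longrightarrow> g m = g m'"
  shows "(\<Sum>m\<in>K. c m * g m) = 0"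
proof -
  have "(\<Sum>m | m \<in> K \<and> \<mu> m = v. c m * g m) = 0" if v: "v \<in> \<mu> ` K" for v
  proof -
    obtain m0 where m0: "m0 \<in> K" "v = \<mu> m0" using v by auto
    have "(\<Sum>m | m \<in> K \<and> \<mu> m = v. c m * g m) = (\<Sum>m | m \<in> K \<and> \<mu> m = v. c m * g m0)"
      using m0(2) by (intro sum.cong refl) (simp add: assms(3)[OF _ m0(1)])
    then show ?thesis using assms(2)[of v] by (simp flip: sum_distrib_right)
  qed
  then show ?thesis by (simp add: sum.image_gen[OF assms(1), of _ \<mu>])
qed

section \<open>Weights separating finitely many exponents\<close>

text \<open>Induction on the coordinates. The old weights handle every vector with
  \<open>d i v = 0\<close>; each vector with \<open>d i v \<noteq> 0\<close> forbids at most one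
  value of the weight at \<open>v\<close>, so only finitely many values have to be avoided.\<close>

lemma exists_separating_weight_int:
  fixes d :: "'i \<Rightarrow> 'k \<Rightarrow> int"
  assumes "finite V" "finite D" "\<And>i. i \<in> D \<Longrightarrow> \<exists>k\<in>V. d i k \<noteq> 0"
  shows "\<exists>a :: 'k \<Rightarrow> nat. \<forall>i\<in>D. (\<Sum>k\<in>V. int (a k) * d i k) \<noteq> 0"
  using assms
proof (induction V arbitrary: D rule: finite_induct)
  case empty
  then show ?case by auto
next
  case (insert v V)
  let ?D = "{i \<in> D. \<exists>k\<in>V. d i k \<noteq> 0}"
  have "\<exists>a :: 'k \<Rightarrow> nat. \<forall>i\<in>?D. (\<Sum>k\<in>V. int (a k) * d i k) \<noteq> 0"
  proof (rule insert.IH)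
    show "finite ?D" using insert.prems(1) by simp
  qed simp
  then obtain a :: "'k \<Rightarrow> nat" where a: "\<forall>i\<in>?D. (\<Sum>k\<in>V. int (a k) * d i k) \<noteq> 0"
    by (rule exE)
  let ?s = "\<lambda>i. \<Sum>k\<in>V. int (a k) * d i k"
  \<comment> \<open>If the linear equation \<open>n * d i v + ?s i = 0\<close> with
    \<open>d i v \<noteq> 0\<close> has a natural solution \<open>n\<close>, it is this
    quotient.\<close>
  have "finite ((\<lambda>i. nat (- ?s i div d i v)) ` D)"
    using insert.prems(1) by (rule finite_imageI)
  then obtain n where n: "n \<notin> (\<lambda>i. nat (- ?s i div d i v)) ` D"
    using ex_new_if_finite infinite_UNIV_nat by blast
  have "(\<Sum>k\<in>insert v V. int ((a(v := n)) k) * d i k) \<noteq> 0" if i: "i \<in> D" for i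
  proof
    assume "(\<Sum>k\<in>insert v V. int ((a(v := n)) k) * d i k) = 0"
    moreover have "(\<Sum>k\<in>V. int ((a(v := n)) k) * d i k) = ?s i"
      using insert.hyps by (intro sum.cong) auto
    ultimately have eq: "int n * d i v + ?s i = 0" using insert.hyps by simp
    show False
    proof (cases "d i v = 0")
      case True
      then have "i \<in> ?D" using i insert.prems(2)[OF i] by auto
      then have "?s i \<noteq> 0" using a by (rule bspec[rotated])
      then show False using eq True by simp
    next
      case False
      have "- ?s i = int n * d i v" using eq by simp
      then have "nat (- ?s i div d i v) = n" using False by simp
      then have "n \<in> (\<lambda>i. nat (- ?s i div d i v)) ` D" using i by (intro image_eqI) (rule sym)
      with n show False by (rule notE)
    qed
  qed
  then show ?case by (intro exI[of _ "a(v := n)"] ballI)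
qed

text \<open>One-parameter subgroups \<open>s \<mapsto> (s\<^bsup>a k\<^esup>)\<^sub>k\<close> with such exponents keep distinct monomials distinct.\<close>

lemma exists_separating_weight:
  fixes M :: "('k \<Rightarrow>\<^sub>0 nat) set"
  assumes "finite M"
  shows "\<exists>a :: 'k \<Rightarrow> nat. inj_on (madd a) M"
proof -
  let ?V = "\<Union>m\<in>M. keys m"
  let ?D = "{(m, n). m \<in> M \<and> n \<in> M \<and> m \<noteq> n}"
  let ?d = "\<lambda>(m, n) k. int (lookup m k) - int (lookup n k)"
  have fin: "finite ?V" using assms by auto
  have "?D \<subseteq> M \<times> M" by auto
  then have finD: "finite ?D" by (rule finite_subset) (simp add: assms)
  have "\<exists>k\<in>?V. ?d i k \<noteq> 0" if "i \<in> ?D" for i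
  proof -
    obtain m n where i: "i = (m, n)" by (cases i)
    then have mn: "m \<in> M" "n \<in> M" "m \<noteq> n" using that by simp_all
    then obtain k where k: "lookup m k \<noteq> lookup n k" by (metis poly_mapping_eqI)
    then have "lookup m k \<noteq> 0 \<or> lookup n k \<noteq> 0" by auto
    then have "k \<in> ?V" using mn by (metis UN_I in_keys_iff)
    then show ?thesis using k i by auto
  qed
  from exists_separating_weight_int[OF fin finD, of ?d, OF this]
  obtain a :: "'k \<Rightarrow> nat" where a: "\<forall>i\<in>?D. (\<Sum>k\<in>?V. int (a k) * ?d i k) \<noteq> 0"
    by blast
  have madd: "int (madd a m) = (\<Sum>k\<in>?V. int (a k) * int (lookup m k))" if "m \<in> M" for m
    using that by (subst madd_supset[OF fin]) (auto simp: mult.commute)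
  have "m = n" if mn: "m \<in> M" "n \<in> M" "madd a m = madd a n" for m n
  proof (rule ccontr)
    assume "m \<noteq> n"
    then have "(m, n) \<in> ?D" using mn by simp
    from bspec[OF a this]
    have "int (madd a m) \<noteq> int (madd a n)"
      unfolding madd[OF mn(1)] madd[OF mn(2)] by (simp add: right_diff_distrib sum_subtractf)
    then show False using mn by simp
  qed
  then show ?thesis by (auto simp: inj_on_def)
qed

section \<open>The Zariski topology\<close>

lemma sum_single_lookup: "(\<Sum>m\<in>keys f. single m (lookup f m)) = f"
  by (intro poly_mapping_eqI) (auto simp: lookup_sum lookup_single when_def in_keys_iff)

lemma eval_sum: "eval x (sum f A) = (\<Sum>i\<in>A. eval x (f i))"
  by (induction A rule: infinite_finite_induct) (simp_all add: eval_add)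

lemma eval_mult: "eval x (f * g) = eval x f * eval x g"
proof -
  have "f * g = (\<Sum>m\<in>keys f. \<Sum>n\<in>keys g. single (m + n) (lookup f m * lookup g n))"
    by (subst sum_single_lookup[of f, symmetric], subst sum_single_lookup[of g, symmetric])
      (simp add: sum_product mult_single)
  then have "eval x (f * g) = (\<Sum>m\<in>keys f. \<Sum>n\<in>keys g. (lookup f m * meval x m) * (lookup g n * meval x n))"
    by (simp add: eval_sum eval_single mult_ac)
  then show ?thesis by (simp add: eval_eq sum_product)
qed

lemma homogeneous_alt: "homogeneous f \<longleftrightarrow> (\<exists>d. \<forall>m\<in>keys f. madd (\<lambda>_. 1 :: nat) m = d)"
  by (simp add: homogeneous_def madd_def)

lemma homogeneous_mult:
  assumes "homogeneous f" "homogeneous g"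
  shows "homogeneous (f * g)"
proof -
  obtain d e where d: "\<forall>m\<in>keys f. madd (\<lambda>_. 1 :: nat) m = d"
    and e: "\<forall>m\<in>keys g. madd (\<lambda>_. 1 :: nat) m = e"
    using assms unfolding homogeneous_alt by blast
  have "madd (\<lambda>_. 1 :: nat) m = d + e" if m: "m \<in> keys (f * g)" for m
  proof -
    obtain a b where "m = a + b" "a \<in> keys f" "b \<in> keys g"
      using m keys_mult[of f g] by blast
    then show ?thesis using d e by simp
  qed
  then show ?thesis unfolding homogeneous_alt by blast
qed

lemma polys_mult:
  assumes "f \<in> polys V" "g \<in> polys V"
  shows "f * g \<in> polys V"
proof -
  have "keys m \<subseteq> V" if m: "m \<in> keys (f * g)" for m
  proof -
    obtain a b where "m = a + b" "a \<in> keys f" "b \<in> keys g"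
      using m keys_mult[of f g] by blast
    then show ?thesis using assms by (simp add: keys_monomial_add polys_def)
  qed
  then show ?thesis by (simp add: polys_def)
qed

lemma eval_homogeneous_scale:
  assumes "homogeneous f" "c \<noteq> 0"
  shows "eval (\<lambda>v. c * x v) f = 0 \<longleftrightarrow> eval x f = 0"
proof -
  obtain d where d: "\<forall>m\<in>keys f. madd (\<lambda>_. 1 :: nat) m = d"
    using assms unfolding homogeneous_alt by blast
  have "meval (\<lambda>v. c * x v) m = c ^ madd (\<lambda>_. 1 :: nat) m * meval x m" for m
    by (induction m rule: monomial_induct) (simp_all add: power_add mult_ac del: One_nat_def)
  then have "eval (\<lambda>v. c * x v) f = c ^ d * eval x f"
    unfolding eval_eq sum_distrib_left using d by (intro sum.cong) auto
  then show ?thesis using assms(2) by simp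
qed

lemma proj_point_self: "x \<in> proj_point x"
  unfolding proj_point_def by (auto intro: exI[of _ 1])

text \<open>Scaling a representative multiplies the value of a homogeneous polynomial by a power of
  a nonzero constant, so a single representative decides.\<close>

lemma zero_set_homogeneous_iff:
  assumes "\<forall>f\<in>S. homogeneous f"
  shows "proj_point x \<in> zero_set V S \<longleftrightarrow> proj_point x \<in> proj_space V \<and> (\<forall>f\<in>S. eval x f = 0)"
proof -
  have "(\<forall>y\<in>proj_point x. eval y f = 0) \<longleftrightarrow> eval x f = 0" if "f \<in> S" for f
    using assms that proj_point_self[of x] by (auto simp: proj_point_def eval_homogeneous_scale)
  then show ?thesis unfolding zero_set_def by blast
qed

text \<open>Products of one equation from each set cut out the union, since the complex numbers have
  no zero divisors.\<close>

lemma zariski_closed_Un: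
  assumes "zariski_closed V A" "zariski_closed V B"
  shows "zariski_closed V (A \<union> B)"
proof -
  obtain S where S: "S \<subseteq> polys V" "\<forall>f\<in>S. homogeneous f" "A = zero_set V S"
    using assms(1) unfolding zariski_closed_def by blast
  obtain S' where S': "S' \<subseteq> polys V" "\<forall>f\<in>S'. homogeneous f" "B = zero_set V S'"
    using assms(2) unfolding zariski_closed_def by blast
  let ?R = "{f * g | f g. f \<in> S \<and> g \<in> S'}"
  have R: "\<forall>f\<in>?R. homogeneous f" using S(2) S'(2) homogeneous_mult by blast
  have "l \<in> A \<union> B \<longleftrightarrow> l \<in> zero_set V ?R" for l
  proof (cases "l \<in> proj_space V")
    case True
    then obtain x where x: "l = proj_point x" by (auto simp: proj_space_def)
    have "(\<forall>f\<in>S. eval x f = 0) \<or> (\<forall>g\<in>S'. eval x g = 0) \<longleftrightarrow> (\<forall>h\<in>?R. eval x h = 0)"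
    proof
      assume "(\<forall>f\<in>S. eval x f = 0) \<or> (\<forall>g\<in>S'. eval x g = 0)"
      then show "\<forall>h\<in>?R. eval x h = 0" by (auto simp: eval_mult)
    next
      assume *: "\<forall>h\<in>?R. eval x h = 0"
      have "eval x f * eval x g = 0" if "f \<in> S" "g \<in> S'" for f g
      proof -
        have "f * g \<in> ?R" using that by blast
        with * have "eval x (f * g) = 0" by (rule bspec)
        then show ?thesis by (simp add: eval_mult)
      qed
      then show "(\<forall>f\<in>S. eval x f = 0) \<or> (\<forall>g\<in>S'. eval x g = 0)" by auto
    qed
    then show ?thesis
      using True unfolding S(3) S'(3) x Un_iff zero_set_homogeneous_iff[OF S(2)]
        zero_set_homogeneous_iff[OF S'(2)] zero_set_homogeneous_iff[OF R] by blast
  next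
    case False
    then show ?thesis unfolding S(3) S'(3) by (simp add: zero_set_def)
  qed
  then have "A \<union> B = zero_set V ?R" by blast
  moreover have "?R \<subseteq> polys V" using S(1) S'(1) polys_mult by blast
  ultimately show ?thesis unfolding zariski_closed_def using R by blast
qed

lemma zariski_closed_empty: "zariski_closed V {}"
proof -
  have "zero_set V {single 0 1} = {}"
  proof -
    have "l \<notin> zero_set V {single 0 1}" for l
    proof
      assume "l \<in> zero_set V {single 0 1}"
      then obtain x where "proj_point x \<in> zero_set V {single 0 1}"
        by (auto simp: zero_set_def proj_space_def)
      then have "eval x (single 0 1) = 0"
        unfolding zero_set_def using proj_point_self by blast
      then show False by (simp only: eval_single meval_0) simp
    qed
    then show ?thesis by blast
  qed
  moreover have "single 0 1 \<in> polys V" "homogeneous (single 0 1)"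
    by (auto simp: polys_def homogeneous_def)
  ultimately show ?thesis unfolding zariski_closed_def
    by (intro exI[of _ "{single 0 1}"]) simp
qed

section \<open>Finite covers of irreducible sets\<close>

lemma zariski_closed_Union:
  "finite \<C> \<Longrightarrow> (\<And>C. C \<in> \<C> \<Longrightarrow> zariski_closed V C) \<Longrightarrow> zariski_closed V (\<Union>\<C>)"
  by (induction \<C> rule: finite_induct) (simp_all add: zariski_closed_empty zariski_closed_Un)

lemma irreducible_subset_finite_cover:
  assumes "irreducible_subset V Y" "finite \<C>" "\<And>C. C \<in> \<C> \<Longrightarrow> zariski_closed V C" "Y \<subseteq> \<Union>\<C>"
  shows "\<exists>C\<in>\<C>. Y \<subseteq> C"
  using assms(2-4)
proof (induction \<C> rule: finite_induct)
  case empty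
  then show ?case using assms(1) by (simp add: irreducible_subset_def)
next
  case (insert C \<C>)
  have "zariski_closed V C" "zariski_closed V (\<Union>\<C>)"
    using insert.prems(1) insert.hyps(1) by (auto intro: zariski_closed_Union)
  then have "Y \<subseteq> C \<or> Y \<subseteq> \<Union>\<C>"
    using assms(1) insert.prems(2) unfolding irreducible_subset_def by (metis Union_insert)
  then show ?case using insert.IH insert.prems(1) by blast
qed

section \<open>Relative Hibi varieties\<close>

text \<open>The exponent vector of the monomial to which \<open>hibi_hom\<close> sends the variable
  of \<open>J\<close>.\<close>

definition hexp :: "'p rel \<Rightarrow> 'p set \<Rightarrow> 'p hibi_var \<Rightarrow>\<^sub>0 nat" where
  "hexp r' J = single T 1 + (\<Sum>p\<in>max_elements r' J. single (Z p) 1)"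

lemma single_prod: "(\<Prod>p\<in>A. single (g p) (1 :: 'a :: comm_semiring_1)) = single (\<Sum>p\<in>A. g p) 1"
  by (induction A rule: infinite_finite_induct) (simp_all add: mult_single)

lemma hibi_hom_eq:
  "hibi_hom r' f = (\<Sum>m\<in>keys f. single (madd (hexp r') m) (lookup f m))"
proof -
  have var_hexp: "var T * (\<Prod>p\<in>max_elements r' J. var (Z p)) = single (hexp r' J) 1" for J
    by (simp add: var_def hexp_def single_prod mult_single)
  have power: "single k (1 :: complex) ^ n = single (\<Sum>i<n. k) 1" for k :: "'p hibi_var \<Rightarrow>\<^sub>0 nat" and n
    by (induction n) (simp_all add: mult_single add.commute)
  show ?thesis
    unfolding hibi_hom_def poly_hom_def var_hexp power single_prod madd_def
    by (simp add: const_def mult_single)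
qed

text \<open>The coefficient of the image at \<open>v\<close> collects the coefficients of
  \<open>f\<close> over the fibre of the exponent map, so membership in the kernel can be tested
  fibre by fibre.\<close>

lemma hibi_hom_eq_0_iff:
  "hibi_hom r' f = 0 \<longleftrightarrow> (\<forall>v. (\<Sum>m | m \<in> keys f \<and> madd (hexp r') m = v. lookup f m) = 0)"
proof -
  have "lookup (hibi_hom r' f) v = (\<Sum>m | m \<in> keys f \<and> madd (hexp r') m = v. lookup f m)" for v
    by (simp add: hibi_hom_eq lookup_sum lookup_single when_def sum.If_cases Int_def)
  then show ?thesis by (metis (mono_tags, lifting) lookup_zero poly_mapping_eqI)
qed

lemma single_diff_in_kernel:
  assumes "madd (hexp r') m = madd (hexp r') n"
  shows "hibi_hom r' (single m 1 - single n 1) = 0"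
proof (cases "m = n")
  case False
  have k: "keys (single m 1 - single n (1 :: complex)) = {m, n}"
    using False by (auto simp: in_keys_iff lookup_minus lookup_single when_def split: if_splits)
  show ?thesis
    unfolding hibi_hom_eq k using False assms
    by (simp add: lookup_minus lookup_single single_diff)
qed (simp add: hibi_hom_eq)

text \<open>The relative Hibi ideal written for an arbitrary family \<open>E\<close>. It thus makes
  sense for a tight family before the order that defines this family has been constructed.\<close>

abbreviation toric_ideal :: "'p rel \<Rightarrow> 'p set set \<Rightarrow> 'p set cpoly set" where
  "toric_ideal r' E \<equiv> {f \<in> polys E. hibi_hom r' f = 0}"

section \<open>Order ideals, maximal elements and the operation \<open>*\<close>\<close>

locale hibi_poset =
  fixes P :: "'p set" and r' :: "'p rel"
  assumes finite_P: "finite P" and order: "partial_order_on P r'"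
begin

lemmas r'_refl = refl_onD[OF partial_order_onD(1)[OF order]]
lemmas r'_trans = transD[OF partial_order_onD(2)[OF order]]
lemmas r'_antisym = antisymD[OF partial_order_onD(3)[OF order]]

lemma r'_field: "(p, q) \<in> r' \<Longrightarrow> p \<in> P \<and> q \<in> P"
  using partial_order_onD(4)[OF order] by blast

abbreviation "ideals \<equiv> order_ideals P r'"
abbreviation "mx \<equiv> max_elements r'"
abbreviation "st \<equiv> star P r'"

lemma ideal_subset: "J \<in> ideals \<Longrightarrow> J \<subseteq> P"
  by (simp add: order_ideals_def)

lemma ideal_down: "J \<in> ideals \<Longrightarrow> q \<in> J \<Longrightarrow> (p, q) \<in> r' \<Longrightarrow> p \<in> J"
  unfolding order_ideals_def using r'_field by blast

lemma finite_ideal: "J \<in> ideals \<Longrightarrow> finite J"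
  using ideal_subset finite_P finite_subset by blast

lemma max_elements_subset: "mx J \<subseteq> J"
  by (auto simp: max_elements_def)

text \<open>Moving strictly upwards from \<open>q\<close> inside the finite ideal \<open>J\<close>
  shrinks the set of elements above, so the climb ends at a maximal element.\<close>

lemma max_elements_dominate:
  assumes "J \<in> ideals" "q \<in> J"
  shows "\<exists>p\<in>mx J. (q, p) \<in> r'"
  using assms(2)
proof (induction "card {b \<in> J. (q, b) \<in> r'}" arbitrary: q rule: less_induct)
  case less
  show ?case
  proof (cases "q \<in> mx J")
    case True
    then show ?thesis using less.prems ideal_subset[OF assms(1)] r'_refl by blast
  next
    case False
    then obtain b where b: "b \<in> J" "(q, b) \<in> r'" "b \<noteq> q"
      using less.prems by (auto simp: max_elements_def)
    have "q \<notin> {c \<in> J. (b, c) \<in> r'}" using b r'_antisym by blast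
    moreover have "q \<in> {c \<in> J. (q, c) \<in> r'}"
      using less.prems ideal_subset[OF assms(1)] r'_refl by blast
    moreover have "{c \<in> J. (b, c) \<in> r'} \<subseteq> {c \<in> J. (q, c) \<in> r'}"
      using b r'_trans by blast
    ultimately have "card {c \<in> J. (b, c) \<in> r'} < card {c \<in> J. (q, c) \<in> r'}"
      using finite_ideal[OF assms(1)] by (intro psubset_card_mono) auto
    from less.hyps[OF this b(1)] show ?thesis using b(2) r'_trans by blast
  qed
qed

lemma Un_ideal: "J1 \<in> ideals \<Longrightarrow> J2 \<in> ideals \<Longrightarrow> J1 \<union> J2 \<in> ideals"
  unfolding order_ideals_def by blast

abbreviation gens :: "'p set \<Rightarrow> 'p set \<Rightarrow> 'p set" where
  "gens J1 J2 \<equiv> (J1 \<inter> J2) \<inter> (mx J1 \<union> mx J2)"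

lemma star_eq:
  assumes "J1 \<in> ideals" "J2 \<in> ideals"
  shows "st J1 J2 = {q. \<exists>p\<in>gens J1 J2. (q, p) \<in> r'}"
  unfolding star_def
proof (rule hull_unique)
  show "gens J1 J2 \<subseteq> {q. \<exists>p\<in>gens J1 J2. (q, p) \<in> r'}"
  proof
    fix p assume p: "p \<in> gens J1 J2"
    then have "(p, p) \<in> r'" using ideal_subset[OF assms(1)] r'_refl by blast
    then show "p \<in> {q. \<exists>p\<in>gens J1 J2. (q, p) \<in> r'}" using p by blast
  qed
  show "{q. \<exists>p\<in>gens J1 J2. (q, p) \<in> r'} \<in> ideals"
    unfolding order_ideals_def using r'_field r'_trans by blast
next
  fix J assume "gens J1 J2 \<subseteq> J" "J \<in> ideals"
  then show "{q. \<exists>p\<in>gens J1 J2. (q, p) \<in> r'} \<subseteq> J"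
    using ideal_down by blast
qed

lemma star_subset: "J1 \<in> ideals \<Longrightarrow> J2 \<in> ideals \<Longrightarrow> st J1 J2 \<subseteq> J1 \<inter> J2"
  using ideal_down by (auto simp: star_eq)

lemma gens_subset_star: "J1 \<in> ideals \<Longrightarrow> J2 \<in> ideals \<Longrightarrow> gens J1 J2 \<subseteq> st J1 J2"
  unfolding star_def by (rule hull_subset)

text \<open>The star lies in \<open>J1 \<inter> J2\<close>, so an element that is maximal in one of
  the two ideals stays maximal in the star. Conversely every element of the star lies below a
  generator.\<close>

lemma max_elements_star:
  assumes "J1 \<in> ideals" "J2 \<in> ideals"
  shows "mx (st J1 J2) = gens J1 J2"
proof
  show "mx (st J1 J2) \<subseteq> gens J1 J2"
    using gens_subset_star[OF assms] assms by (auto simp: max_elements_def star_eq)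
  show "gens J1 J2 \<subseteq> mx (st J1 J2)"
    using gens_subset_star[OF assms] star_subset[OF assms] by (auto simp: max_elements_def)
qed

lemma max_elements_Un:
  assumes "J1 \<in> ideals" "J2 \<in> ideals"
  shows "mx (J1 \<union> J2) = (mx J1 - J2) \<union> (mx J2 - J1) \<union> (mx J1 \<inter> mx J2)"
  using ideal_down[OF assms(1)] ideal_down[OF assms(2)]
  by (auto simp: max_elements_def)

text \<open>The maximal elements of \<open>J1 \<union> J2\<close> and of \<open>st J1 J2\<close>
  have the same union and the same intersection as those of \<open>J1\<close> and \<open>J2\<close>.
  Hence every \<open>z_p\<close> occurs equally often on both sides.\<close>

lemma hexp_straighten:
  assumes "J1 \<in> ideals" "J2 \<in> ideals"
  shows "hexp r' J1 + hexp r' J2 = hexp r' (J1 \<union> J2) + hexp r' (st J1 J2)"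
proof -
  let ?g = "\<lambda>p. single (Z p) (1::nat)"
  have fin: "finite (mx J)" if "J \<in> ideals" for J
    using finite_ideal[OF that] max_elements_subset finite_subset by blast
  have fin': "finite (mx (J1 \<union> J2))" "finite (mx (st J1 J2))"
    using fin[OF assms(1)] fin[OF assms(2)] fin[OF Un_ideal[OF assms]]
    by (auto simp: max_elements_star[OF assms])
  have un: "mx J1 \<union> mx J2 = mx (J1 \<union> J2) \<union> mx (st J1 J2)"
    and int: "mx J1 \<inter> mx J2 = mx (J1 \<union> J2) \<inter> mx (st J1 J2)"
    using max_elements_subset[of J1] max_elements_subset[of J2]
    unfolding max_elements_star[OF assms] max_elements_Un[OF assms] by blast+
  have "sum ?g (mx J1) + sum ?g (mx J2) = sum ?g (mx (J1 \<union> J2)) + sum ?g (mx (st J1 J2))"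
    using sum.union_inter[OF fin[OF assms(1)] fin[OF assms(2)], of ?g]
      sum.union_inter[OF fin', of ?g] un int by simp
  then show ?thesis by (simp add: hexp_def ac_simps)
qed

lemma lookup_hexp_T [simp]: "lookup (hexp r' J) T = 1"
  by (simp add: hexp_def lookup_add lookup_sum lookup_single)

lemma lookup_hexp_Z:
  assumes "J \<in> ideals"
  shows "lookup (hexp r' J) (Z p) = (if p \<in> mx J then 1 else 0)"
proof -
  have "finite (mx J)" using finite_ideal[OF assms] max_elements_subset finite_subset by blast
  then show ?thesis by (simp add: hexp_def lookup_add lookup_sum lookup_single when_def)
qed

section \<open>The defining quadrics\<close>

definition binom :: "'p set \<Rightarrow> 'p set \<Rightarrow> 'p set cpoly" where
  "binom J1 J2 = single (single J1 1 + single J2 1) 1 - single (single (J1 \<union> J2) 1 + single (st J1 J2) 1) 1"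

lemma eval_binom: "eval x (binom J1 J2) = x J1 * x J2 - x (J1 \<union> J2) * x (st J1 J2)"
  by (simp add: binom_def eval_diff eval_single del: One_nat_def)

text \<open>Only an inclusion can hold: for comparable ideals the two monomials coincide and the
  binomial is zero.\<close>

lemma keys_binom:
  "keys (binom J1 J2) \<subseteq> {single J1 1 + single J2 1, single (J1 \<union> J2) 1 + single (st J1 J2) 1}"
  by (auto simp: binom_def in_keys_iff lookup_minus lookup_single when_def split: if_splits)

lemma binom_in_polys:
  assumes "J1 \<in> V" "J2 \<in> V" "J1 \<union> J2 \<in> V" "st J1 J2 \<in> V"
  shows "binom J1 J2 \<in> polys V"
proof -
  have "keys m \<subseteq> V" if "m \<in> keys (binom J1 J2)" for m
  proof -
    have "m = single J1 1 + single J2 1 \<or> m = single (J1 \<union> J2) 1 + single (st J1 J2) 1"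
      using that keys_binom by blast
    then show ?thesis using assms by (elim disjE) (simp_all add: keys_monomial_add)
  qed
  then show ?thesis by (simp add: polys_def)
qed

lemma homogeneous_binom: "homogeneous (binom J1 J2)"
proof -
  have "\<forall>m\<in>keys (binom J1 J2). madd (\<lambda>_. 1 :: nat) m = 2"
    using keys_binom[of J1 J2] by (auto simp del: One_nat_def)
  then show ?thesis unfolding homogeneous_alt by blast
qed

lemma binom_in_kernel:
  "J1 \<in> ideals \<Longrightarrow> J2 \<in> ideals \<Longrightarrow> hibi_hom r' (binom J1 J2) = 0"
  unfolding binom_def by (rule single_diff_in_kernel) (simp add: hexp_straighten del: One_nat_def)

end

section \<open>Straightening in a family closed under union and \<open>*\<close>\<close>

locale hibi_family = hibi_poset P r' for P :: "'p set" and r' +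
  fixes E :: "'p set set"
  assumes E_ideals: "E \<subseteq> ideals"
    and E_Un: "J1 \<in> E \<Longrightarrow> J2 \<in> E \<Longrightarrow> J1 \<union> J2 \<in> E"
    and E_star: "J1 \<in> E \<Longrightarrow> J2 \<in> E \<Longrightarrow> st J1 J2 \<in> E"
begin

definition quadric_zero :: "('p set \<Rightarrow> complex) \<Rightarrow> bool" where
  "quadric_zero y \<longleftrightarrow> (\<forall>J1\<in>E. \<forall>J2\<in>E. y J1 * y J2 = y (J1 \<union> J2) * y (st J1 J2))"

text \<open>The leading pair \<open>K\<close>, \<open>A\<close> is replaced by its union, which is
  carried on, and its star, which is put aside. Each replacement preserves the value of the product
  and the total exponent.\<close>

lemma straighten:
  assumes "quadric_zero y" "K \<in> E" "set Ks \<subseteq> E"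
  shows "\<exists>Ks'. set Ks' \<subseteq> E \<and> length Ks' = length Ks \<and>
     y K * prod_list (map y Ks) = y (\<Union>(set (K # Ks))) * prod_list (map y Ks') \<and>
     hexp r' K + sum_list (map (hexp r') Ks) =
       hexp r' (\<Union>(set (K # Ks))) + sum_list (map (hexp r') Ks')"
  using assms(2,3)
proof (induction Ks arbitrary: K)
  case Nil
  then show ?case by simp
next
  case (Cons A Ks)
  have A: "A \<in> E" "set Ks \<subseteq> E" using Cons.prems by auto
  have KA: "K \<in> ideals" "A \<in> ideals" using E_ideals A Cons.prems by auto
  obtain Ks' where Ks': "set Ks' \<subseteq> E" "length Ks' = length Ks"
     "y (K \<union> A) * prod_list (map y Ks) = y (\<Union>(set ((K \<union> A) # Ks))) * prod_list (map y Ks')"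
     "hexp r' (K \<union> A) + sum_list (map (hexp r') Ks) =
       hexp r' (\<Union>(set ((K \<union> A) # Ks))) + sum_list (map (hexp r') Ks')"
    using Cons.IH[OF E_Un[OF Cons.prems(1) A(1)] A(2)] by blast
  have U: "\<Union>(set ((K \<union> A) # Ks)) = \<Union>(set (K # A # Ks))" by auto
  have "y K * prod_list (map y (A # Ks)) = (y K * y A) * prod_list (map y Ks)"
    by (simp add: mult.assoc)
  also have "\<dots> = y (st K A) * (y (K \<union> A) * prod_list (map y Ks))"
    using assms(1) Cons.prems(1) A(1) by (simp add: quadric_zero_def)
  also have "\<dots> = y (\<Union>(set (K # A # Ks))) * prod_list (map y (st K A # Ks'))"
    unfolding Ks'(3) U by simp
  finally have y: "y K * prod_list (map y (A # Ks)) =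
    y (\<Union>(set (K # A # Ks))) * prod_list (map y (st K A # Ks'))" .
  have "hexp r' K + sum_list (map (hexp r') (A # Ks)) =
      (hexp r' K + hexp r' A) + sum_list (map (hexp r') Ks)"
    by (simp add: add.assoc)
  also have "\<dots> = hexp r' (st K A) + (hexp r' (K \<union> A) + sum_list (map (hexp r') Ks))"
    unfolding hexp_straighten[OF KA] by (simp only: ac_simps)
  also have "\<dots> = hexp r' (\<Union>(set (K # A # Ks))) + sum_list (map (hexp r') (st K A # Ks'))"
    unfolding Ks'(4) U by (simp add: ac_simps)
  finally show ?case using y Ks'(1,2) E_star[OF Cons.prems(1) A(1)]
    by (intro exI[of _ "st K A # Ks'"]) simp
qed

text \<open>An ideal is generated by its maximal elements, and those of all factors are visible as
  the \<open>z_p\<close> with nonzero exponent. So the leading factor after straightening depends on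
  the total exponent alone.\<close>

lemma Union_from_hexp:
  assumes "set Ks \<subseteq> E"
  shows "\<Union>(set Ks) = {q. \<exists>p. (q, p) \<in> r' \<and> lookup (sum_list (map (hexp r') Ks)) (Z p) \<noteq> 0}"
proof -
  have "lookup (sum_list (map (hexp r') Ks)) (Z p) \<noteq> 0 \<longleftrightarrow> (\<exists>K\<in>set Ks. p \<in> mx K)" for p
  proof -
    have "\<forall>K\<in>set Ks. K \<in> ideals" using assms E_ideals by auto
    then show ?thesis by (induction Ks) (auto simp: lookup_add lookup_hexp_Z)
  qed
  moreover have "K = {q. \<exists>p\<in>mx K. (q, p) \<in> r'}" if "K \<in> set Ks" for K
  proof -
    have "K \<in> ideals" using assms E_ideals that by auto
    then show ?thesis
      using max_elements_dominate ideal_down max_elements_subset by blast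
  qed
  ultimately show ?thesis by blast
qed

lemma lookup_hexp_sum_T: "lookup (sum_list (map (hexp r') Ks)) T = length Ks"
  by (induction Ks) (simp_all add: lookup_add)

text \<open>Induction on the degree, which is the exponent of \<open>T\<close>. Straightening gives
  both products the same leading factor; its exponent is cancelled and the induction hypothesis
  applies to the rest. Values of \<open>y\<close> are never divided, so zero coordinates do no
  harm.\<close>

lemma quadric_zero_list:
  assumes "quadric_zero y" "set Ks \<subseteq> E" "set Ls \<subseteq> E"
    and "sum_list (map (hexp r') Ks) = sum_list (map (hexp r') Ls)"
  shows "prod_list (map y Ks) = prod_list (map y Ls)"
  using assms(2-)
proof (induction "length Ks" arbitrary: Ks Ls)
  case 0
  then have "length Ls = 0" by (metis lookup_hexp_sum_T)
  then show ?case using 0 by simp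
next
  case (Suc n)
  have "length Ls = Suc n" using Suc by (metis lookup_hexp_sum_T)
  with Suc(2) obtain K Ks' L Ls' where KL: "Ks = K # Ks'" "Ls = L # Ls'"
    "length Ks' = n" "length Ls' = n"
    by (metis length_Suc_conv)
  have eq: "\<Union>(set (L # Ls')) = \<Union>(set (K # Ks'))"
    using Union_from_hexp[OF Suc.prems(1)] Union_from_hexp[OF Suc.prems(2)] Suc.prems(3) KL by metis
  have in_E: "K \<in> E" "set Ks' \<subseteq> E" "L \<in> E" "set Ls' \<subseteq> E" using Suc.prems KL by auto
  obtain A where A: "set A \<subseteq> E" "length A = n"
     "y K * prod_list (map y Ks') = y (\<Union>(set (K # Ks'))) * prod_list (map y A)"
     "hexp r' K + sum_list (map (hexp r') Ks') =
       hexp r' (\<Union>(set (K # Ks'))) + sum_list (map (hexp r') A)"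
    using straighten[OF assms(1) in_E(1,2)] KL by metis
  obtain B where B: "set B \<subseteq> E" "length B = n"
     "y L * prod_list (map y Ls') = y (\<Union>(set (K # Ks'))) * prod_list (map y B)"
     "hexp r' L + sum_list (map (hexp r') Ls') =
       hexp r' (\<Union>(set (K # Ks'))) + sum_list (map (hexp r') B)"
    using straighten[OF assms(1) in_E(3,4)] KL eq by metis
  have "sum_list (map (hexp r') A) = sum_list (map (hexp r') B)"
    using A(4) B(4) Suc.prems(3) KL by simp
  then have "prod_list (map y A) = prod_list (map y B)"
    using Suc.hyps(1)[of A B] A B by simp
  then show ?case using A(3) B(3) KL by simp
qed

lemma quadric_zero_meval:
  assumes "quadric_zero y" "keys m \<subseteq> E" "keys n \<subseteq> E" "madd (hexp r') m = madd (hexp r') n"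
  shows "meval y m = meval y n"
proof -
  obtain Ks where "set Ks = keys m" "meval y m = prod_list (map y Ks)"
    "madd (hexp r') m = sum_list (map (hexp r') Ks)" using monomial_as_list[of m y "hexp r'"] by blast
  moreover obtain Ls where "set Ls = keys n" "meval y n = prod_list (map y Ls)"
    "madd (hexp r') n = sum_list (map (hexp r') Ls)" using monomial_as_list[of n y "hexp r'"] by blast
  ultimately show ?thesis using quadric_zero_list[OF assms(1), of Ks Ls] assms by simp
qed

section \<open>The variety of a closed family\<close>

definition hibi_variety :: "('p set \<Rightarrow> complex) set set" where
  "hibi_variety = zero_set E (toric_ideal r' E)"

text \<open>The kernel contains the binomials. Conversely, at a zero of the quadrics the monomials
  in one fibre of the exponent map agree, while the coefficients of a kernel element sum to zero
  over it. The ambient \<open>V\<close> allows use inside a larger projective space.\<close>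

lemma hibi_variety_iff:
  assumes "E \<subseteq> V" "l \<in> proj_space V"
  shows "l \<in> hibi_variety \<longleftrightarrow> (\<forall>x\<in>l. x \<in> coord_space E \<and> quadric_zero x)"
proof
  assume l: "l \<in> hibi_variety"
  then obtain x0 where x0: "l = proj_point x0" "x0 \<in> coord_space E"
    by (auto simp: hibi_variety_def zero_set_def proj_space_def)
  show "\<forall>x\<in>l. x \<in> coord_space E \<and> quadric_zero x"
  proof (intro ballI conjI)
    fix x assume x: "x \<in> l"
    then show "x \<in> coord_space E" using x0 by (auto simp: proj_point_def coord_space_def)
    show "quadric_zero x" unfolding quadric_zero_def
    proof (intro ballI)
      fix J1 J2 assume J: "J1 \<in> E" "J2 \<in> E"
      have "binom J1 J2 \<in> polys E"
        using J E_Un[OF J] E_star[OF J] by (rule binom_in_polys)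
      moreover have "hibi_hom r' (binom J1 J2) = 0"
        using J E_ideals by (intro binom_in_kernel) auto
      ultimately have "eval x (binom J1 J2) = 0"
        using l x by (auto simp: hibi_variety_def zero_set_def)
      then show "x J1 * x J2 = x (J1 \<union> J2) * x (st J1 J2)" by (simp add: eval_binom)
    qed
  qed
next
  assume *: "\<forall>x\<in>l. x \<in> coord_space E \<and> quadric_zero x"
  obtain x0 where x0: "l = proj_point x0" "x0 \<noteq> (\<lambda>v. 0)"
    using assms(2) by (auto simp: proj_space_def)
  have "x0 \<in> l" unfolding x0 proj_point_def by (auto intro: exI[of _ 1])
  then have "l \<in> proj_space E" using x0 * by (auto simp: proj_space_def)
  moreover have "eval x f = 0" if x: "x \<in> l" and f: "f \<in> polys E" "hibi_hom r' f = 0" for x f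
    unfolding eval_eq
  proof (rule sum_fibres_zero)
    show "(\<Sum>m | m \<in> keys f \<and> madd (hexp r') m = v. lookup f m) = 0" for v
      using f(2) by (simp add: hibi_hom_eq_0_iff)
    show "meval x m = meval x m'"
      if "m \<in> keys f" "m' \<in> keys f" "madd (hexp r') m = madd (hexp r') m'" for m m'
      using that f(1) * x by (intro quadric_zero_meval) (auto simp: polys_def)
  qed simp
  ultimately show "l \<in> hibi_variety" by (simp add: hibi_variety_def zero_set_def)
qed

lemma hibi_variety_subset: "E \<subseteq> V \<Longrightarrow> hibi_variety \<subseteq> proj_space V"
  by (auto simp: hibi_variety_def zero_set_def proj_space_def coord_space_def) blast

lemma zariski_closed_hibi_variety:
  assumes "E \<subseteq> V"
  shows "zariski_closed V hibi_variety"
  unfolding zariski_closed_def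
proof (intro exI conjI)
  \<comment> \<open>The variables outside \<open>E\<close> cut out the coordinate subspace in which
    the variety lies.\<close>
  let ?S = "{binom J1 J2 | J1 J2. J1 \<in> E \<and> J2 \<in> E} \<union> {single (single J 1) 1 | J. J \<in> V - E}"
  have "binom J1 J2 \<in> polys V" if "J1 \<in> E" "J2 \<in> E" for J1 J2
    using that E_Un[OF that] E_star[OF that] assms by (intro binom_in_polys) auto
  then show "?S \<subseteq> polys V" by (auto simp: polys_def)
  show "\<forall>f\<in>?S. homogeneous f"
  proof
    fix f assume "f \<in> ?S"
    moreover have "homogeneous (single (single J 1) 1)" for J :: "'p set"
      by (auto simp: homogeneous_def)
    ultimately show "homogeneous f" using homogeneous_binom by auto
  qed
  show "hibi_variety = zero_set V ?S"
  proof (rule set_eqI)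
    fix l
    show "l \<in> hibi_variety \<longleftrightarrow> l \<in> zero_set V ?S"
    proof (cases "l \<in> proj_space V")
      case True
      have "(\<forall>f\<in>?S. eval x f = 0) \<longleftrightarrow> x \<in> coord_space E \<and> quadric_zero x" if "x \<in> l" for x
      proof -
        have xV: "x \<in> coord_space V"
          using True that by (auto simp: proj_space_def proj_point_def coord_space_def)
        have "(\<forall>f\<in>?S. eval x f = 0) \<longleftrightarrow>
           (\<forall>J1\<in>E. \<forall>J2\<in>E. eval x (binom J1 J2) = 0) \<and> (\<forall>J\<in>V - E. eval x (single (single J 1) 1) = 0)"
          by blast
        also have "\<dots> \<longleftrightarrow> quadric_zero x \<and> (\<forall>J\<in>V - E. x J = 0)"
          by (simp add: eval_binom eval_single quadric_zero_def del: One_nat_def)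
        also have "\<dots> \<longleftrightarrow> x \<in> coord_space E \<and> quadric_zero x"
          using xV assms by (auto simp: coord_space_def)
        finally show ?thesis .
      qed
      then show ?thesis using True by (simp add: hibi_variety_iff[OF assms] zero_set_def)
    next
      case False
      then show ?thesis using hibi_variety_subset[OF assms] by (auto simp: zero_set_def)
    qed
  qed
qed

text \<open>Suppose two closed sets cover the variety and neither contains it. Each has an equation
  not vanishing on the variety, and this equation has a nonzero pullback along the monomial
  parametrization. A separating curve keeps both pullbacks nonzero, so some torus point of the
  variety escapes both sets.\<close>

lemma irreducible_hibi_variety:
  assumes "E \<subseteq> V" "E \<noteq> {}"
  shows "irreducible_subset V hibi_variety"
proof -
  \<comment> \<open>The monomial parametrization, extended by zero outside \<open>E\<close>.\<close>
  define pt where "pt z J = (if J \<in> E then meval z (hexp r' J) else 0)" for z :: "'p hibi_var \<Rightarrow> complex" and J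
  have meval_pt: "meval (pt z) m = (if keys m \<subseteq> E then meval z (madd (hexp r') m) else 0)" for z m
  proof (cases "keys m \<subseteq> E")
    case True
    then have "meval (pt z) m = meval (\<lambda>J. meval z (hexp r' J)) m"
      by (intro meval_cong) (auto simp: pt_def)
    then show ?thesis using True by (simp add: meval_madd)
  next
    case False
    then show ?thesis by (auto simp: pt_def intro: meval_eq_0)
  qed
  have pt_mem: "proj_point (pt z) \<in> hibi_variety" if z: "\<And>k. z k \<noteq> 0" for z
  proof -
    have "pt z \<in> coord_space E" by (simp add: pt_def coord_space_def)
    moreover obtain J where "J \<in> E" using assms by auto
    then have "pt z J \<noteq> 0" using z by (simp add: pt_def meval_def)
    then have "pt z \<noteq> (\<lambda>v. 0)" by auto
    ultimately have "proj_point (pt z) \<in> proj_space E" by (auto simp: proj_space_def)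
    moreover have "quadric_zero (\<lambda>J. c * pt z J)" for c
    proof -
      have "pt z J1 * pt z J2 = pt z (J1 \<union> J2) * pt z (st J1 J2)" if J: "J1 \<in> E" "J2 \<in> E" for J1 J2
      proof -
        have "hexp r' J1 + hexp r' J2 = hexp r' (J1 \<union> J2) + hexp r' (st J1 J2)"
          using J E_ideals by (intro hexp_straighten) auto
        then have "meval z (hexp r' J1 + hexp r' J2) = meval z (hexp r' (J1 \<union> J2) + hexp r' (st J1 J2))"
          by simp
        then show ?thesis using J E_Un[OF J] E_star[OF J] by (simp add: pt_def)
      qed
      then show ?thesis by (auto simp: quadric_zero_def mult_ac)
    qed
    ultimately show ?thesis
      by (subst hibi_variety_iff[of E]) (auto simp: proj_point_def coord_space_def pt_def)
  qed
  have nonempty: "hibi_variety \<noteq> {}" using pt_mem[of "\<lambda>_. 1"] by auto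
  \<comment> \<open>The fibre sums are the coefficients of the pullback of \<open>f\<close> along
    \<open>pt\<close>; monomials that involve a variable outside \<open>E\<close> pull back to zero.
    If all fibre sums vanished, \<open>f\<close> would vanish at \<open>x\<close>.\<close>
  have coeff_nonzero: "\<exists>v. (\<Sum>m | m \<in> {m \<in> keys f. keys m \<subseteq> E} \<and> madd (hexp r') m = v. lookup f m) \<noteq> 0"
    if "x \<in> l" "l \<in> hibi_variety" "eval x f \<noteq> 0" for x l f
  proof (rule ccontr)
    assume *: "\<not> ?thesis"
    have lE: "l \<in> proj_space E" using that by (simp add: hibi_variety_def zero_set_def)
    have x: "x \<in> coord_space E" "quadric_zero x"
      using that(1,2) by (auto simp: hibi_variety_iff[OF order_refl lE])
    have "eval x f = (\<Sum>m\<in>{m \<in> keys f. keys m \<subseteq> E}. lookup f m * meval x m)"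
      unfolding eval_eq
    proof (rule sum.mono_neutral_right)
      show "\<forall>m\<in>keys f - {m \<in> keys f. keys m \<subseteq> E}. lookup f m * meval x m = 0"
        using x(1) by (auto simp: coord_space_def intro: meval_eq_0)
    qed auto
    also have "\<dots> = 0"
    proof (rule sum_fibres_zero)
      show "(\<Sum>m | m \<in> {m \<in> keys f. keys m \<subseteq> E} \<and> madd (hexp r') m = v. lookup f m) = 0" for v
        using * by simp
      show "meval x m = meval x m'"
        if "m \<in> {m \<in> keys f. keys m \<subseteq> E}" "m' \<in> {m \<in> keys f. keys m \<subseteq> E}"
          "madd (hexp r') m = madd (hexp r') m'" for m m'
        using that x(2) by (intro quadric_zero_meval) auto
    qed simp
    finally show False using that(3) by simp
  qed
  have "hibi_variety \<subseteq> zero_set V SA \<or> hibi_variety \<subseteq> zero_set V SB"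
    if cover: "hibi_variety \<subseteq> zero_set V SA \<union> zero_set V SB" for SA SB
  proof (rule ccontr)
    assume "\<not> ?thesis"
    then obtain la lb where la: "la \<in> hibi_variety" "la \<notin> zero_set V SA"
      and lb: "lb \<in> hibi_variety" "lb \<notin> zero_set V SB" by blast
    then have "la \<in> proj_space V" "lb \<in> proj_space V" using hibi_variety_subset[OF assms(1)] by auto
    then obtain x f y g where f: "x \<in> la" "f \<in> SA" "eval x f \<noteq> 0"
      and g: "y \<in> lb" "g \<in> SB" "eval y g \<noteq> 0"
      using la lb by (auto simp: zero_set_def)
    let ?\<mu> = "madd (hexp r')"
    let ?K = "\<lambda>f. {m \<in> keys f. keys m \<subseteq> E}"
    have finK: "finite (?K f)" for f :: "'p set cpoly" by simp
    obtain a :: "'p hibi_var \<Rightarrow> nat" where a: "inj_on (madd a) (?\<mu> ` ?K f \<union> ?\<mu> ` ?K g)"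
      using exists_separating_weight[OF finite_UnI[OF finite_imageI[OF finK] finite_imageI[OF finK]]]
      by (rule exE)
    \<comment> \<open>The pullback of \<open>h\<close> to the curve
      \<open>s \<mapsto> pt (\<lambda>k. s ^ a k)\<close>. As \<open>a\<close> separates the
      exponents that occur, its coefficients are single fibre sums.\<close>
    define q where "q h = (\<Sum>m\<in>?K h. monom (lookup h m) (madd a (?\<mu> m)))" for h :: "'p set cpoly"
    have q_nonzero: "q h \<noteq> 0"
      if v: "(\<Sum>m | m \<in> ?K h \<and> ?\<mu> m = v. lookup h m) \<noteq> 0" and inj: "inj_on (madd a) (?\<mu> ` ?K h)" for h v
    proof -
      obtain m0 where "m0 \<in> {m. m \<in> ?K h \<and> ?\<mu> m = v}"
        by (rule sum.not_neutral_contains_not_neutral[OF v])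
      then have "v \<in> ?\<mu> ` ?K h" by blast
      then have eq_iff: "madd a (?\<mu> m) = madd a v \<longleftrightarrow> ?\<mu> m = v" if "m \<in> ?K h" for m
        using inj that by (intro inj_on_eq_iff) auto
      have "coeff (q h) (madd a v) = (\<Sum>m\<in>?K h. if madd a (?\<mu> m) = madd a v then lookup h m else 0)"
        by (simp add: q_def coeff_sum)
      also have "\<dots> = (\<Sum>m | m \<in> ?K h \<and> madd a (?\<mu> m) = madd a v. lookup h m)"
        by (simp add: sum.If_cases Int_def)
      also have "{m. m \<in> ?K h \<and> madd a (?\<mu> m) = madd a v} = {m. m \<in> ?K h \<and> ?\<mu> m = v}"
        using eq_iff by blast
      finally show ?thesis using v by auto
    qed
    have "q f \<noteq> 0"
      using coeff_nonzero[OF f(1) la(1) f(3)] q_nonzero[OF _ inj_on_subset[OF a Un_upper1]]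
      by (elim exE)
    moreover have "q g \<noteq> 0"
      using coeff_nonzero[OF g(1) lb(1) g(3)] q_nonzero[OF _ inj_on_subset[OF a Un_upper2]]
      by (elim exE)
    \<comment> \<open>The factor \<open>[:0, 1:]\<close> forces \<open>s \<noteq> 0\<close>, so that
      the point found lies in the torus.\<close>
    ultimately have "q f * q g * [:0, 1:] \<noteq> 0" by simp
    then have "finite {s. poly (q f * q g * [:0, 1:]) s = 0}" by (rule poly_roots_finite)
    then obtain s where s: "s \<notin> {s. poly (q f * q g * [:0, 1:]) s = 0}"
      using ex_new_if_finite infinite_UNIV_char_0 by blast
    then have s0: "s \<noteq> 0" "poly (q f) s \<noteq> 0" "poly (q g) s \<noteq> 0" by auto
    define z where "z k = s ^ a k" for k
    have z_meval: "meval z v = s ^ madd a v" for v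
      by (induction v rule: monomial_induct) (simp_all add: z_def power_add del: One_nat_def)
    have eval_pt: "eval (pt z) h = poly (q h) s" for h
    proof -
      have "eval (pt z) h = (\<Sum>m\<in>?K h. lookup h m * meval (pt z) m)"
        unfolding eval_eq by (rule sum.mono_neutral_right) (auto simp: meval_pt)
      also have "\<dots> = (\<Sum>m\<in>?K h. lookup h m * s ^ madd a (?\<mu> m))"
        by (rule sum.cong) (auto simp: meval_pt z_meval)
      finally show ?thesis by (simp add: q_def poly_sum poly_monom)
    qed
    have z_nz: "z k \<noteq> 0" for k using s0 by (simp add: z_def)
    have "proj_point (pt z) \<in> zero_set V SA \<union> zero_set V SB"
      by (rule subsetD[OF cover pt_mem[OF z_nz]])
    moreover have self: "pt z \<in> proj_point (pt z)" unfolding proj_point_def by (auto intro: exI[of _ 1])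
    have "eval (pt z) h = 0" if "proj_point (pt z) \<in> zero_set V S" "h \<in> S" for h S
      using that self unfolding zero_set_def by blast
    ultimately have "eval (pt z) f = 0 \<or> eval (pt z) g = 0"
      using f(2) g(2) by (metis Un_iff)
    then show False using s0 by (simp add: eval_pt)
  qed
  then show ?thesis
    using nonempty hibi_variety_subset[OF assms(1)]
    unfolding irreducible_subset_def zariski_closed_def by blast
qed

end

section \<open>Tight families\<close>

text \<open>Each term of an element of a monomial ideal is divisible by one of the monomial
  generators.\<close>

lemma monomial_hibi_ideal_keys:
  assumes "f \<in> monomial_hibi_ideal P r" "m \<in> keys f"
  shows "\<exists>J1\<in>keys m. \<exists>J2\<in>keys m. \<not> J1 \<subseteq> J2 \<and> \<not> J2 \<subseteq> J1"
proof -
  let ?G = "{var J1 * var J2 | J1 J2.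
          J1 \<in> order_ideals P r \<and> J2 \<in> order_ideals P r \<and> \<not> J1 \<subseteq> J2 \<and> \<not> J2 \<subseteq> J1}"
  obtain S a where S: "f = (\<Sum>g\<in>S. a g * g)" "S \<subseteq> ?G"
    using assms(1) unfolding monomial_hibi_ideal_def ideal_generated_def by blast
  then obtain g where g: "g \<in> S" "m \<in> keys (a g * g)"
    using assms(2) keys_sum[of "\<lambda>g. a g * g" S] by blast
  obtain J1 J2 where J: "g = var J1 * var J2" "\<not> J1 \<subseteq> J2" "\<not> J2 \<subseteq> J1"
    using g(1) S(2) by blast
  have "g = single (single J1 1 + single J2 1) 1"
    unfolding J(1) var_def by (simp add: mult_single)
  then have "keys g \<subseteq> {single J1 1 + single J2 1}" by simp
  then obtain u where "m = u + (single J1 1 + single J2 1)"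
    using g(2) keys_mult[of "a g" g] by blast
  then have "J1 \<in> keys m" "J2 \<in> keys m" by (auto simp: keys_monomial_add)
  then show ?thesis using J by blast
qed

section \<open>Maximal chains and flags\<close>

lemma finite_maximalE:
  fixes X :: "'a set set"
  assumes "finite X" "a \<in> X"
  obtains M where "M \<in> X" "\<forall>B\<in>X. M \<subseteq> B \<longrightarrow> M = B"
  using finite_has_maximal2[OF assms] by auto

lemma finite_minimalE:
  fixes X :: "'a set set"
  assumes "finite X" "a \<in> X"
  obtains M where "M \<in> X" "\<forall>B\<in>X. B \<subseteq> M \<longrightarrow> M = B"
  using finite_has_minimal2[OF assms] by auto

lemma maximal_chain_extends:
  assumes "finite V" "D \<subseteq> V" "chain_subset D"
  shows "\<exists>F. D \<subseteq> F \<and> F \<subseteq> V \<and> chain_subset F \<and>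
    (\<forall>J\<in>V. (\<forall>A\<in>F. A \<subseteq> J \<or> J \<subseteq> A) \<longrightarrow> J \<in> F)"
proof -
  let ?X = "{F. D \<subseteq> F \<and> F \<subseteq> V \<and> chain_subset F}"
  have "finite ?X" using assms(1) by (rule finite_subset[rotated, OF finite_Pow_iff[THEN iffD2]]) auto
  moreover have "D \<in> ?X" using assms by simp
  ultimately obtain F where F: "F \<in> ?X" "\<forall>G\<in>?X. F \<subseteq> G \<longrightarrow> F = G"
    by (rule finite_maximalE)
  have max: "J \<in> F" if "J \<in> V" "\<forall>A\<in>F. A \<subseteq> J \<or> J \<subseteq> A" for J
  proof -
    have "insert J F \<in> ?X" using F(1) that unfolding chain_subset_def by auto
    from bspec[OF F(2) this] show ?thesis by blast
  qed
  show ?thesis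
  proof (intro exI conjI ballI impI)
    show "D \<subseteq> F" "F \<subseteq> V" "chain_subset F" using F(1) by auto
  qed (rule max)
qed

text \<open>Flags are the chains of prefixes of linear extensions.\<close>

definition flag :: "'p set \<Rightarrow> 'p set set \<Rightarrow> bool" where
  "flag P F \<longleftrightarrow> chain_subset F \<and> {} \<in> F \<and> P \<in> F \<and> (\<forall>A\<in>F. A \<noteq> {} \<longrightarrow> (\<exists>p\<in>A. A - {p} \<in> F))"

text \<open>In a maximal chain of ideals consecutive members differ by one point, since a maximal
  element of \<open>A\<close> outside its predecessor can be removed. The lemma is later applied
  with the stronger order in place of \<open>r'\<close>, which puts the flags into \<J>.\<close>

lemma (in hibi_poset) chain_extends_to_flag:
  assumes "D \<subseteq> ideals" "chain_subset D"
  shows "\<exists>F. D \<subseteq> F \<and> F \<subseteq> ideals \<and> flag P F"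
proof -
  have fin: "finite ideals"
    using finite_P by (rule finite_subset[rotated, OF finite_Pow_iff[THEN iffD2]]) (auto simp: order_ideals_def)
  obtain F where F: "D \<subseteq> F" "F \<subseteq> ideals" "chain_subset F"
    and max': "\<forall>J\<in>ideals. (\<forall>A\<in>F. A \<subseteq> J \<or> J \<subseteq> A) \<longrightarrow> J \<in> F"
    using maximal_chain_extends[OF fin assms] by (elim exE conjE)
  have max: "J \<in> F" if "J \<in> ideals" "\<And>A. A \<in> F \<Longrightarrow> A \<subseteq> J \<or> J \<subseteq> A" for J
    using bspec[OF max' that(1)] that(2) by simp
  have empty: "{} \<in> F" by (rule max) (auto simp: order_ideals_def)
  have P: "P \<in> F" using F(2) by (intro max) (auto simp: order_ideals_def)
  have "\<exists>p\<in>A. A - {p} \<in> F" if A: "A \<in> F" "A \<noteq> {}" for A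
  proof -
    let ?X = "{B \<in> F. B \<subset> A}"
    have "finite ?X" using fin F(2) finite_subset[of F] by auto
    moreover have "{} \<in> ?X" using empty A by auto
    ultimately obtain B where B: "B \<in> ?X" and B_max: "\<forall>C\<in>?X. B \<subseteq> C \<longrightarrow> B = C"
      by (rule finite_maximalE)
    then obtain q where q: "q \<in> A" "q \<notin> B" by blast
    have ids: "A \<in> ideals" "B \<in> ideals" using A B F(2) by auto
    \<comment> \<open>Going up from \<open>q\<close> to a maximal element stays outside
      \<open>B\<close>, because \<open>B\<close> is closed downwards.\<close>
    obtain p where p: "p \<in> mx A" "(q, p) \<in> r'" using max_elements_dominate[OF ids(1) q(1)] by blast
    have pB: "p \<notin> B" using ideal_down[OF ids(2) _ p(2)] q(2) by blast
    have pA: "p \<in> A" using p(1) by (simp add: max_elements_def)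
    have "A - {p} \<in> F"
    proof (rule max)
      show "A - {p} \<in> ideals"
        using ids(1) p(1) unfolding order_ideals_def max_elements_def by blast
      fix C assume C: "C \<in> F"
      have "C \<subseteq> A \<or> A \<subseteq> C" using F(3) A C unfolding chain_subset_def by blast
      moreover have "C \<subseteq> B" if "C \<subset> A"
        using bspec[OF B_max, of C] that C B F(3) unfolding chain_subset_def by blast
      ultimately show "C \<subseteq> A - {p} \<or> A - {p} \<subseteq> C" using pB B(1) by blast
    qed
    then show ?thesis using pA by blast
  qed
  then show ?thesis using F empty P unfolding flag_def by blast
qed

section \<open>Affine functions interpolating the weight on a flag\<close>

locale weighted_hibi_family = hibi_family P r' V for P :: "'p set" and r' V +
  fixes w :: "'p set \<Rightarrow> real"
  assumes w_le: "J1 \<in> V \<Longrightarrow> J2 \<in> V \<Longrightarrow> w J1 + w J2 \<le> w (J1 \<union> J2) + w (st J1 J2)"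
begin

text \<open>Linear in the exponent vector. As \<open>T\<close> always has exponent 1,
  \<open>c T\<close> is the constant term.\<close>

abbreviation aff :: "('p hibi_var \<Rightarrow> real) \<Rightarrow> 'p set \<Rightarrow> real" where
  "aff c J \<equiv> madd c (hexp r' J)"

lemma affine_straighten:
  assumes "J1 \<in> V" "J2 \<in> V"
  shows "aff c J1 + aff c J2 = aff c (J1 \<union> J2) + aff c (st J1 J2)"
  using hexp_straighten[of J1 J2] assms E_ideals by (metis madd_add subsetD)

text \<open>Induction on cardinality along the flag. The point \<open>p\<close> added at a step is
  maximal in the new member and absent from all smaller ones, so \<open>c (Z p)\<close> can be
  chosen without disturbing the values already fixed.\<close>

lemma flag_affine:
  assumes "F \<subseteq> ideals" "flag P F"
  shows "\<exists>c. \<forall>A\<in>F. aff c A = w A"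
proof -
  have fin: "finite A" if "A \<in> F" for A using that assms(1) finite_ideal by blast
  have chain: "A \<subseteq> B \<or> B \<subseteq> A" if "A \<in> F" "B \<in> F" for A B
    using that assms(2) unfolding flag_def chain_subset_def by blast
  have "\<exists>c. \<forall>A\<in>F. card A \<le> k \<longrightarrow> aff c A = w A" for k
  proof (induction k)
    case 0
    \<comment> \<open>The empty ideal has no maximal elements, so only the value at \<open>T\<close>
      counts here.\<close>
    have "aff (\<lambda>_. w {}) {} = w {}"
      by (simp add: hexp_def max_elements_def del: One_nat_def)
    then show ?case using fin by (intro exI[of _ "\<lambda>_. w {}"]) auto
  next
    case (Suc k)
    then obtain c where c: "\<And>A. A \<in> F \<Longrightarrow> card A \<le> k \<Longrightarrow> aff c A = w A" by blast
    show ?case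
    proof (cases "\<exists>A\<in>F. card A = Suc k")
      case False
      then have "\<forall>A\<in>F. card A \<le> Suc k \<longrightarrow> aff c A = w A" using c le_Suc_eq by metis
      then show ?thesis by blast
    next
      case True
      then obtain A where A: "A \<in> F" "card A = Suc k" by blast
      then have "A \<noteq> {}" by auto
      then obtain p where p: "p \<in> A" "A - {p} \<in> F"
        using assms(2) A(1) unfolding flag_def by blast
      have card_p: "card (A - {p}) = k" using A p by simp
      define c' where "c' = c(Z p := c (Z p) + (w A - aff c A))"
      have c': "aff c' B = aff c B + (w A - aff c A) * real (lookup (hexp r' B) (Z p))" for B
        unfolding c'_def by (rule madd_fun_upd)
      have pA: "p \<in> mx A"
      proof -
        have "(p, b) \<notin> r'" if "b \<in> A - {p}" for b
          using ideal_down[of "A - {p}" b p] p(2) that assms(1) by blast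
        then show ?thesis using p(1) unfolding max_elements_def by blast
      qed
      have "aff c' B = w B" if B: "B \<in> F" "card B \<le> Suc k" for B
      proof (cases "B = A")
        case True
        then show ?thesis using c' pA A(1) assms(1) by (simp add: lookup_hexp_Z subsetD)
      next
        case False
        have "B \<subseteq> A \<or> A \<subseteq> B" by (rule chain[OF B(1) A(1)])
        moreover have "\<not> A \<subseteq> B" using False B A card_seteq[OF fin[OF B(1)], of A] by auto
        ultimately have BA: "B \<subset> A" using False by blast
        then have cB: "card B \<le> k" using psubset_card_mono[OF fin[OF A(1)] BA] A(2) by simp
        have "B \<subseteq> A - {p}"
        proof (rule ccontr)
          assume "\<not> ?thesis"
          then have "A - {p} \<subset> B" using chain[OF B(1) p(2)] by blast
          then have "card (A - {p}) < card B" by (rule psubset_card_mono[OF fin[OF B(1)]])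
          then show False using cB card_p by simp
        qed
        then have "p \<notin> mx B" using max_elements_subset by blast
        then have "lookup (hexp r' B) (Z p) = 0"
          using B(1) assms(1) by (simp add: lookup_hexp_Z subsetD)
        then show ?thesis using c' c[OF B(1) cB] by simp
      qed
      then show ?thesis by blast
    qed
  qed
  from this[of "card P"] obtain c where c: "\<forall>A\<in>F. card A \<le> card P \<longrightarrow> aff c A = w A" by blast
  have "card A \<le> card P" if "A \<in> F" for A
    using that assms(1) ideal_subset by (intro card_mono[OF finite_P]) blast
  then show ?thesis using c by blast
qed

text \<open>Induction along the flag. If \<open>J\<close> contains the last point \<open>p\<close>
  of \<open>A\<close>, then \<open>J \<union> (A - {p}) = A\<close>. Subtracting the exact relation
  for \<open>aff c\<close> from the inequality for \<open>w\<close>, with equality on the flag,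
  reduces the claim to the star, which lies in \<open>A - {p}\<close>.\<close>

lemma w_le_affine:
  assumes F: "F \<subseteq> V" "flag P F" "\<And>A. A \<in> F \<Longrightarrow> aff c A = w A" and J: "J \<in> V"
  shows "w J \<le> aff c J"
proof -
  have "w J \<le> aff c J" if "A \<in> F" "J \<in> V" "J \<subseteq> A" for A J
    using that
  proof (induction "card A" arbitrary: A J)
    case 0
    then have "A = {}" using F(1) E_ideals finite_ideal by (metis card_0_eq subsetD)
    then have "J = A" using 0 by blast
    then show ?case using F(3) 0 by simp
  next
    case (Suc k)
    then have "A \<noteq> {}" by auto
    then obtain p where p: "p \<in> A" "A - {p} \<in> F"
      using F(2) Suc.prems(1) unfolding flag_def by blast
    have IH: "\<And>J. J \<in> V \<Longrightarrow> J \<subseteq> A - {p} \<Longrightarrow> w J \<le> aff c J"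
      using Suc.hyps(1)[of "A - {p}"] Suc.hyps(2) p by simp
    show ?case
    proof (cases "J \<subseteq> A - {p}")
      case True
      then show ?thesis using IH Suc.prems(2) by blast
    next
      case False
      let ?B = "A - {p}"
      have un: "J \<union> ?B = A" using False Suc.prems(3) p by blast
      have BV: "?B \<in> V" using p F(1) by blast
      have "st J ?B \<subseteq> ?B"
        using star_subset[of J ?B] Suc.prems(2) BV E_ideals by blast
      then have "w (st J ?B) \<le> aff c (st J ?B)"
        using IH E_star[OF Suc.prems(2) BV] by blast
      moreover have "w J + w ?B \<le> w A + w (st J ?B)"
        using w_le[OF Suc.prems(2) BV] un by simp
      moreover have "aff c J + aff c ?B = aff c A + aff c (st J ?B)"
        using affine_straighten[OF Suc.prems(2) BV] un by simp
      ultimately show ?thesis using F(3)[OF p(2)] F(3)[OF Suc.prems(1)] by linarith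
    qed
  qed
  moreover have "P \<in> F" using F(2) by (simp add: flag_def)
  moreover have "J \<subseteq> P" using J E_ideals ideal_subset by blast
  ultimately show ?thesis using J by blast
qed

section \<open>Tight families and their orders\<close>

definition tight :: "('p hibi_var \<Rightarrow> real) \<Rightarrow> 'p set set" where
  "tight c = {J \<in> V. w J = aff c J}"

lemma tight_subset: "tight c \<subseteq> V"
  by (auto simp: tight_def)

text \<open>With \<open>U\<close> the union and \<open>S\<close> the star, \<open>w J1 + w J2 \<le>
  w U + w S \<le> aff c U + aff c S = aff c J1 + aff c J2\<close>. The two ends agree for tight
  ideals, so every inequality is an equality.\<close>

lemma tight_closed:
  assumes le: "\<And>J. J \<in> V \<Longrightarrow> w J \<le> aff c J" and J: "J1 \<in> tight c" "J2 \<in> tight c"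
  shows "J1 \<union> J2 \<in> tight c \<and> st J1 J2 \<in> tight c \<and> w J1 + w J2 = w (J1 \<union> J2) + w (st J1 J2)"
proof -
  have V: "J1 \<in> V" "J2 \<in> V" using J by (auto simp: tight_def)
  show ?thesis
    using w_le[OF V] affine_straighten[OF V, of c] le[OF E_Un[OF V]] le[OF E_star[OF V]] J
      E_Un[OF V] E_star[OF V] by (auto simp: tight_def)
qed

lemma tight_family:
  assumes "\<And>J. J \<in> V \<Longrightarrow> w J \<le> aff c J"
  shows "hibi_family P r' (tight c)"
  using tight_closed[OF assms] tight_subset[of c] E_ideals by unfold_locales auto

lemma tight_Int:
  assumes le: "\<And>J. J \<in> V \<Longrightarrow> w J \<le> aff c J"
    and F: "flag P F" "F \<subseteq> tight c"
    and J: "J1 \<in> tight c" "J2 \<in> tight c"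
  shows "J1 \<inter> J2 \<in> tight c"
proof -
  note ids = subsetD[OF E_ideals subsetD[OF tight_subset]]
  have F_ids: "A \<in> ideals" if "A \<in> F" for A using that F(2) ids by blast
  txt \<open>The least flag member \<open>A\<close> containing \<open>p\<close> has \<open>p\<close> as a maximal element, so \<open>J1 * A\<close> and then
    \<open>(J1 * A) * J2\<close> contain \<open>p\<close>.\<close>
  have ex: "\<exists>K\<in>tight c. p \<in> K \<and> K \<subseteq> J1 \<inter> J2" if p: "p \<in> J1 \<inter> J2" for p
  proof -
    have "finite {A \<in> F. p \<in> A}"
    proof (rule finite_subset)
      show "{A \<in> F. p \<in> A} \<subseteq> Pow P" using F_ids ideal_subset by blast
    qed (simp add: finite_P)
    moreover have "P \<in> {A \<in> F. p \<in> A}"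
      using p F(1) ideal_subset[OF ids[OF J(1)]] by (auto simp: flag_def)
    ultimately obtain A where A': "A \<in> {A \<in> F. p \<in> A}"
      and min': "\<forall>B\<in>{A \<in> F. p \<in> A}. B \<subseteq> A \<longrightarrow> A = B"
      by (rule finite_minimalE)
    then have A: "A \<in> F" "p \<in> A" by auto
    have min: "A = B" if "B \<in> F" "p \<in> B" "B \<subseteq> A" for B using bspec[OF min', of B] that by simp
    obtain q where q: "q \<in> A" "A - {q} \<in> F"
      using F(1) A unfolding flag_def by blast
    have "p \<notin> A - {q}" using min[OF q(2)] q(1) by blast
    then have "q = p" using A by blast
    then have Ap: "A - {p} \<in> ideals" using q F_ids by blast
    have "p \<in> mx A" unfolding max_elements_def using A ideal_down[OF Ap, of _ p] by blast
    have At: "A \<in> tight c" using A F(2) by blast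
    let ?K = "st J1 A"
    have K: "?K \<in> tight c" using tight_closed[OF le J(1) At] by blast
    have "p \<in> gens J1 A" using p A \<open>p \<in> mx A\<close> by blast
    then have pK: "p \<in> mx ?K"
      using max_elements_star[OF ids[OF J(1)] ids[OF At]] by blast
    have "?K \<subseteq> J1" using star_subset[OF ids[OF J(1)] ids[OF At]] by blast
    moreover have "p \<in> gens ?K J2" using p pK max_elements_subset[of ?K] by blast
    then have "p \<in> st ?K J2" using gens_subset_star[OF ids[OF K] ids[OF J(2)]] by blast
    moreover have "st ?K J2 \<subseteq> ?K \<inter> J2" by (rule star_subset[OF ids[OF K] ids[OF J(2)]])
    moreover have "st ?K J2 \<in> tight c" using tight_closed[OF le K J(2)] by blast
    ultimately show ?thesis by blast
  qed
  let ?X = "{K \<in> tight c. K \<subseteq> J1 \<inter> J2}"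
  \<comment> \<open>Being a union of tight ideals, the intersection is tight; the flag supplies the
    empty union.\<close>
  have Un: "\<Union>?X = J1 \<inter> J2" using ex by blast
  have fin: "finite ?X"
  proof (rule finite_subset)
    show "?X \<subseteq> Pow P" using ids ideal_subset by blast
  qed (simp add: finite_P)
  have "\<Union>X \<in> tight c" if "finite X" "X \<subseteq> tight c" for X
    using that
  proof (induction X rule: finite_induct)
    case empty
    then show ?case using F by (auto simp: flag_def)
  next
    case (insert K X)
    then show ?case using tight_closed[OF le, of K "\<Union>X"] by simp
  qed
  from this[OF fin] show ?thesis using Un by auto
qed

text \<open>A finite family containing \<open>{}\<close> and \<open>P\<close> and closed under union
  and intersection consists of the lower sets of the preorder in which \<open>p\<close> lies below
  \<open>q\<close> when every member containing \<open>q\<close> contains \<open>p\<close>. The flag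
  separates points, which makes this preorder antisymmetric.\<close>

lemma tight_eq_order_ideals:
  assumes le: "\<And>J. J \<in> V \<Longrightarrow> w J \<le> aff c J"
    and F: "flag P F" "F \<subseteq> tight c"
  shows "\<exists>r''. partial_order_on P r'' \<and> order_ideals P r'' = tight c"
proof -
  note ids = subsetD[OF E_ideals subsetD[OF tight_subset]]
  let ?r = "{(p, q). p \<in> P \<and> q \<in> P \<and> (\<forall>A\<in>tight c. q \<in> A \<longrightarrow> p \<in> A)}"
  have sub: "A \<subseteq> P" if "A \<in> tight c" for A using ideal_subset ids that by blast
  have fin: "finite (tight c)"
  proof (rule finite_subset)
    show "tight c \<subseteq> Pow P" using sub by blast
  qed (simp add: finite_P)
  have empty: "{} \<in> tight c" and P: "P \<in> tight c" using F by (auto simp: flag_def)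
  have Un: "\<Union>X \<in> tight c" if "finite X" "X \<subseteq> tight c" for X
    using that
  proof (induction X rule: finite_induct)
    case empty
    then show ?case using \<open>{} \<in> tight c\<close> by simp
  next
    case (insert K X)
    then show ?case using tight_closed[OF le, of K "\<Union>X"] by simp
  qed
  have Int: "P \<inter> \<Inter>X \<in> tight c" if "finite X" "X \<subseteq> tight c" for X
    using that
  proof (induction X rule: finite_induct)
    case empty
    then show ?case using P by simp
  next
    case (insert K X)
    then have "K \<inter> (P \<inter> \<Inter>X) \<in> tight c" using tight_Int[OF le F, of K "P \<inter> \<Inter>X"] by simp
    then show ?case by (simp add: Int_left_commute)
  qed
  have "antisym ?r"
  proof (rule antisymI)
    \<comment> \<open>The least flag member containing \<open>p\<close> loses \<open>p\<close> when
      its last point \<open>s\<close> is removed, hence \<open>s = p\<close>. The same members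
      contain \<open>q\<close>, so \<open>s = q\<close> as well.\<close>
    fix p q assume pq: "(p, q) \<in> ?r" "(q, p) \<in> ?r"
    have "finite {A \<in> F. p \<in> A}" using fin F(2) by (simp add: finite_subset)
    moreover have "P \<in> {A \<in> F. p \<in> A}" using pq F(1) by (auto simp: flag_def)
    ultimately obtain A where A': "A \<in> {A \<in> F. p \<in> A}"
      and min': "\<forall>B\<in>{A \<in> F. p \<in> A}. B \<subseteq> A \<longrightarrow> A = B"
      by (rule finite_minimalE)
    then have A: "A \<in> F" "p \<in> A" by auto
    have min: "A = B" if "B \<in> F" "p \<in> B" "B \<subseteq> A" for B using bspec[OF min', of B] that by simp
    obtain s where s: "s \<in> A" "A - {s} \<in> F"
      using F(1) A unfolding flag_def by blast
    have "p \<notin> A - {s}" using min[OF s(2)] s(1) by blast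
    then have "p = s" using A by blast
    moreover have iff: "p \<in> B \<longleftrightarrow> q \<in> B" if "B \<in> F" for B
      using pq subsetD[OF F(2) that] by auto
    moreover have "q \<in> A" using iff[OF A(1)] A(2) by simp
    moreover have "q \<notin> A - {s}" using iff[OF s(2)] \<open>p \<notin> A - {s}\<close> by simp
    ultimately show "p = q" by blast
  qed
  then have "partial_order_on P ?r"
    by (auto simp: partial_order_on_def preorder_on_def refl_on_def trans_def)
  moreover have "order_ideals P ?r = tight c"
  proof
    show "tight c \<subseteq> order_ideals P ?r" using sub by (auto simp: order_ideals_def)
    show "order_ideals P ?r \<subseteq> tight c"
    proof
      fix J assume J: "J \<in> order_ideals P ?r"
      \<comment> \<open>The least tight ideal containing \<open>q\<close>, which is the principal
        ideal of \<open>q\<close> for the new order.\<close>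
      let ?D = "\<lambda>q. P \<inter> \<Inter>{A \<in> tight c. q \<in> A}"
      have JP: "J \<subseteq> P" using J by (simp add: order_ideals_def)
      have "?D q \<subseteq> J" if "q \<in> J" for q
      proof
        fix p assume "p \<in> ?D q"
        then have "p \<in> P" "(p, q) \<in> ?r" using that JP by auto
        then show "p \<in> J" using J that unfolding order_ideals_def by blast
      qed
      then have "\<Union>(?D ` J) = J" using JP by blast
      moreover have "\<Union>(?D ` J) \<in> tight c"
      proof (rule Un)
        show "finite (?D ` J)" using JP finite_P finite_subset by blast
        show "?D ` J \<subseteq> tight c" using Int fin by (intro image_subsetI) auto
      qed
      ultimately show "J \<in> tight c" by simp
    qed
  qed
  ultimately show ?thesis by blast
qed

text \<open>Descent along the chain \<open>D\<close>, which is maximal in \<open>S\<close>. For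
  consecutive members \<open>B \<subset> A\<close> and \<open>J \<subseteq> A\<close>, the set
  \<open>J \<union> B\<close> is comparable with all of \<open>D\<close>, hence equal to
  \<open>A\<close> or \<open>B\<close>. In the first case the relation for \<open>J\<close> and
  \<open>B\<close> reduces \<open>J\<close> to a star inside \<open>B\<close>; in the second
  \<open>J \<subseteq> B\<close>.\<close>

lemma tight_supports:
  assumes S: "S \<subseteq> V" "S \<noteq> {}" "\<And>J1 J2. J1 \<in> S \<Longrightarrow> J2 \<in> S \<Longrightarrow>
      J1 \<union> J2 \<in> S \<and> st J1 J2 \<in> S \<and> w J1 + w J2 = w (J1 \<union> J2) + w (st J1 J2)"
    and D: "D \<subseteq> S" "chain_subset D" "\<And>J. J \<in> S \<Longrightarrow> (\<And>A. A \<in> D \<Longrightarrow> A \<subseteq> J \<or> J \<subseteq> A) \<Longrightarrow> J \<in> D"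
    and c: "\<And>A. A \<in> D \<Longrightarrow> aff c A = w A"
  shows "S \<subseteq> tight c"
proof
  fix J assume J: "J \<in> S"
  have finD: "finite D"
  proof (rule finite_subset)
    show "D \<subseteq> Pow P" using D(1) S(1) E_ideals ideal_subset by blast
  qed (simp add: finite_P)
  have fin: "finite A" if "A \<in> D" for A
    using that D(1) S(1) E_ideals finite_ideal by blast
  have chain: "A \<subseteq> B \<or> B \<subseteq> A" if "A \<in> D" "B \<in> D" for A B
    using that D(2) unfolding chain_subset_def by blast
  have main: "w J = aff c J" if "A \<in> D" "J \<in> S" "J \<subseteq> A" for A J
    using that
  proof (induction "card A" arbitrary: A J rule: less_induct)
    case less
    let ?X = "{B \<in> D. B \<subset> A}"
    show ?case
    proof (cases "?X = {}")
      case True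
      have "J \<in> D"
      proof (rule D(3)[OF less.prems(2)])
        fix C assume "C \<in> D"
        then have "A \<subseteq> C" using True chain[OF less.prems(1)] by blast
        then show "C \<subseteq> J \<or> J \<subseteq> C" using less.prems(3) by blast
      qed
      then show ?thesis using c by simp
    next
      case False
      then obtain B0 where B0: "B0 \<in> ?X" by blast
      have "finite ?X" using finD by simp
      from this B0 obtain B where B': "B \<in> ?X" and max': "\<forall>C\<in>?X. B \<subseteq> C \<longrightarrow> B = C"
        by (rule finite_maximalE)
      then have B: "B \<in> D" "B \<subset> A" by auto
      have max: "B = C" if "C \<in> D" "C \<subset> A" "B \<subseteq> C" for C using bspec[OF max', of C] that by simp
      have below: "C \<subseteq> B" if "C \<in> D" "C \<subset> A" for C
        using max[OF that] chain[OF that(1) B(1)] by blast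
      have BS: "B \<in> S" using B D(1) by blast
      have cardB: "card B < card A" using psubset_card_mono[OF fin[OF less.prems(1)] B(2)] .
      have un: "J \<union> B \<in> D"
      proof (rule D(3))
        show "J \<union> B \<in> S" using S(3)[OF less.prems(2) BS] by blast
        fix C assume C: "C \<in> D"
        show "C \<subseteq> J \<union> B \<or> J \<union> B \<subseteq> C"
        proof (cases "C \<subset> A")
          case True
          then show ?thesis using below[OF C] by blast
        next
          case False
          then have "A \<subseteq> C" using chain[OF less.prems(1) C] by blast
          then show ?thesis using less.prems(3) B(2) by blast
        qed
      qed
      show ?thesis
      proof (cases "J \<union> B = A")
        case True
        have JB: "J \<in> V" "B \<in> V" using less.prems(2) BS S(1) by auto
        have "st J B \<subseteq> B" using star_subset[of J B] JB E_ideals by blast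
        then have "w (st J B) = aff c (st J B)"
          using less.hyps[OF cardB B(1)] S(3)[OF less.prems(2) BS] by blast
        moreover have "w J + w B = w A + w (st J B)"
          using S(3)[OF less.prems(2) BS] True by simp
        moreover have "aff c J + aff c B = aff c A + aff c (st J B)"
          using affine_straighten[OF JB, of c] True by simp
        ultimately show ?thesis using c[OF B(1)] c[OF less.prems(1)] by linarith
      next
        case False
        then have "J \<union> B \<subset> A" using less.prems(3) B(2) by blast
        then have "J \<subseteq> B" using below[OF un] by blast
        then show ?thesis using less.hyps[OF cardB B(1) less.prems(2)] by blast
      qed
    qed
  qed
  have "D \<noteq> {}" using D(3)[OF J] by blast
  then obtain A0 where "A0 \<in> D" by blast
  with finD obtain A where A: "A \<in> D" and max: "\<forall>C\<in>D. A \<subseteq> C \<longrightarrow> A = C"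
    by (rule finite_maximalE)
  have top: "C \<subseteq> A" if "C \<in> D" for C using bspec[OF max that] chain[OF that A] by blast
  have "J \<union> A \<in> D"
  proof (rule D(3))
    show "J \<union> A \<in> S" using S(3)[OF J] A D(1) by blast
    show "C \<subseteq> J \<union> A \<or> J \<union> A \<subseteq> C" if "C \<in> D" for C using top[OF that] by blast
  qed
  then have "J \<subseteq> A" using bspec[OF max, of "J \<union> A"] by blast
  then show "J \<in> tight c" using main[OF A J] J S(1) by (auto simp: tight_def)
qed

end

section \<open>Components of the initial degeneration\<close>

text \<open>All maximal elements of the smaller ideal are generators of the star, and they generate
  that ideal. The weight inequality is therefore trivial for comparable pairs.\<close>

lemma (in hibi_poset) star_comparable:
  assumes "J1 \<in> ideals" "J2 \<in> ideals" "J1 \<subseteq> J2"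
  shows "st J1 J2 = J1" "st J2 J1 = J1"
proof -
  have "J1 \<subseteq> {q. \<exists>p\<in>gens J1 J2. (q, p) \<in> r'}"
  proof
    fix q assume "q \<in> J1"
    then obtain p where "p \<in> mx J1" "(q, p) \<in> r'"
      using max_elements_dominate[OF assms(1)] by blast
    then show "q \<in> {q. \<exists>p\<in>gens J1 J2. (q, p) \<in> r'}"
      using assms(3) max_elements_subset[of J1] by blast
  qed
  then show "st J1 J2 = J1" using star_eq[OF assms(1,2)] star_subset[OF assms(1,2)] by blast
  moreover have "st J2 J1 = st J1 J2" by (simp add: star_def Int_commute Un_commute)
  ultimately show "st J2 J1 = J1" by simp
qed

section \<open>Inequalities satisfied by the closed cone\<close>

context hibi_family
begin

lemma binom_in_toric_ideal: "J1 \<in> E \<Longrightarrow> J2 \<in> E \<Longrightarrow> binom J1 J2 \<in> toric_ideal r' E"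
  using E_ideals by (auto intro!: binom_in_polys binom_in_kernel E_Un E_star)

lemma weight_pair: "weight w (single J1 1 + single J2 1) = w J1 + w J2"
  by (simp add: weight_eq_madd del: One_nat_def)

text \<open>If the inequality failed, the initial form of the binomial would contain the monomial of
  the union and the star. These two ideals are comparable, so the monomial cannot occur in the
  monomial ideal.\<close>

lemma initial_cone_le:
  assumes w: "initial_ideal w (toric_ideal r' E) = monomial_hibi_ideal P r"
    and J: "J1 \<in> E" "J2 \<in> E"
  shows "w J1 + w J2 \<le> w (J1 \<union> J2) + w (st J1 J2)"
proof (cases "J1 \<subseteq> J2 \<or> J2 \<subseteq> J1")
  case True
  have ids: "J1 \<in> ideals" "J2 \<in> ideals" using J E_ideals by auto
  from True show ?thesis
  proof
    assume "J1 \<subseteq> J2"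
    then show ?thesis using star_comparable[OF ids] by (simp add: Un_absorb1)
  next
    assume "J2 \<subseteq> J1"
    then show ?thesis using star_comparable[OF ids(2,1)] by (simp add: Un_absorb2)
  qed
next
  case False
  have ids: "J1 \<in> ideals" "J2 \<in> ideals" using J E_ideals by auto
  let ?m = "single J1 1 + single J2 1 :: 'p set \<Rightarrow>\<^sub>0 nat"
  let ?n = "single (J1 \<union> J2) 1 + single (st J1 J2) 1 :: 'p set \<Rightarrow>\<^sub>0 nat"
  show ?thesis
  proof (rule ccontr)
    assume "\<not> ?thesis"
    then have wt: "weight w ?n < weight w ?m" unfolding weight_pair by simp
    then have "?m \<noteq> ?n" by (metis less_irrefl)
    then have "?n \<in> keys (binom J1 J2)"
      by (simp add: binom_def in_keys_iff lookup_minus lookup_single when_def del: One_nat_def)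
    moreover have "weight w ?n \<le> weight w u" if "u \<in> keys (binom J1 J2)" for u
      using that keys_binom[of J1 J2] wt by auto
    ultimately have "?n \<in> keys (initial_form w (binom J1 J2))"
      by (simp add: keys_initial_form)
    moreover have "initial_form w (binom J1 J2) \<in> monomial_hibi_ideal P r"
      unfolding w[symmetric] initial_ideal_def
      by (rule cpoly.span_base[OF imageI[OF binom_in_toric_ideal[OF J]]])
    ultimately have "\<exists>A\<in>keys ?n. \<exists>B\<in>keys ?n. \<not> A \<subseteq> B \<and> \<not> B \<subseteq> A"
      by (rule monomial_hibi_ideal_keys[rotated])
    then obtain A B where AB: "A \<in> keys ?n" "B \<in> keys ?n" "\<not> A \<subseteq> B" "\<not> B \<subseteq> A"
      by (elim bexE conjE)
    have "keys ?n = {J1 \<union> J2, st J1 J2}" by (auto simp: keys_monomial_add)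
    moreover have "st J1 J2 \<subseteq> J1 \<union> J2" using star_subset[OF ids] by blast
    ultimately show False using AB by auto
  qed
qed

text \<open>A weak linear inequality in finitely many coordinates defines a closed
  half-space.\<close>

lemma closure_initial_cone_le:
  assumes w: "w \<in> closure (initial_cone E (toric_ideal r' E) (monomial_hibi_ideal P r))"
    and J: "J1 \<in> E" "J2 \<in> E"
  shows "w J1 + w J2 \<le> w (J1 \<union> J2) + w (st J1 J2)"
proof -
  let ?C = "{w :: 'p set \<Rightarrow> real. w J1 + w J2 \<le> w (J1 \<union> J2) + w (st J1 J2)}"
  have "closed ?C"
    by (intro closed_Collect_le continuous_on_add continuous_on_product_coordinates)
  moreover have "initial_cone E (toric_ideal r' E) (monomial_hibi_ideal P r) \<subseteq> ?C"
    using initial_cone_le[OF _ J] by (auto simp: initial_cone_def)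
  ultimately show ?thesis using w closure_minimal by blast
qed

end

section \<open>The zero set of the initial ideal\<close>

context weighted_hibi_family
begin

text \<open>For equal weights the binomial is its own initial form; otherwise the initial form is
  the monomial of \<open>J1\<close> and \<open>J2\<close> alone.\<close>

lemma binom_relations:
  assumes x: "\<forall>f\<in>toric_ideal r' V. eval x (initial_form w f) = 0"
    and J: "J1 \<in> V" "J2 \<in> V"
  shows "w J1 + w J2 = w (J1 \<union> J2) + w (st J1 J2) \<Longrightarrow> x J1 * x J2 = x (J1 \<union> J2) * x (st J1 J2)"
    and "w J1 + w J2 < w (J1 \<union> J2) + w (st J1 J2) \<Longrightarrow> x J1 * x J2 = 0"
proof -
  let ?m = "single J1 1 + single J2 1 :: 'p set \<Rightarrow>\<^sub>0 nat"
  let ?n = "single (J1 \<union> J2) 1 + single (st J1 J2) 1 :: 'p set \<Rightarrow>\<^sub>0 nat"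
  have ev: "eval x (initial_form w (binom J1 J2)) = 0"
    using x binom_in_toric_ideal[OF J] by (rule bspec)
  have keys: "u = ?m \<or> u = ?n" if "u \<in> keys (binom J1 J2)" for u
    using that keys_binom[of J1 J2] by auto
  {
    assume "w J1 + w J2 = w (J1 \<union> J2) + w (st J1 J2)"
    then have wt: "weight w ?m = weight w ?n" unfolding weight_pair by simp
    have wt_eq: "weight w u = weight w ?n" if "u \<in> keys (binom J1 J2)" for u
      using keys[OF that] wt by (elim disjE) simp_all
    have "initial_form w (binom J1 J2) = binom J1 J2"
    proof (rule poly_mapping_eqI)
      fix u
      show "lookup (initial_form w (binom J1 J2)) u = lookup (binom J1 J2) u"
      proof (cases "u \<in> keys (binom J1 J2)")
        case True
        then have "\<forall>v\<in>keys (binom J1 J2). weight w u \<le> weight w v" by (simp add: wt_eq)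
        then show ?thesis using True by (simp add: initial_form_lookup)
      next
        case False
        then show ?thesis by (simp add: initial_form_lookup in_keys_iff)
      qed
    qed
    then show "x J1 * x J2 = x (J1 \<union> J2) * x (st J1 J2)" using ev by (simp add: eval_binom)
  next
    assume "w J1 + w J2 < w (J1 \<union> J2) + w (st J1 J2)"
    then have wt: "weight w ?m < weight w ?n" unfolding weight_pair by simp
    then have mn: "?m \<noteq> ?n" by (metis less_irrefl)
    then have lm: "lookup (binom J1 J2) ?m = 1"
      by (simp add: binom_def lookup_minus lookup_single when_def del: One_nat_def)
    then have mk: "?m \<in> keys (binom J1 J2)" by (simp add: in_keys_iff)
    have min: "weight w ?m \<le> weight w u" if "u \<in> keys (binom J1 J2)" for u
      using keys[OF that] wt by (elim disjE) simp_all
    have "initial_form w (binom J1 J2) = single ?m 1"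
    proof (rule poly_mapping_eqI)
      fix u
      show "lookup (initial_form w (binom J1 J2)) u = lookup (single ?m 1) u"
      proof (cases "u = ?m")
        case True
        then show ?thesis unfolding True initial_form_lookup using mk min lm by simp
      next
        case False
        have "\<not> (u \<in> keys (binom J1 J2) \<and> (\<forall>v\<in>keys (binom J1 J2). weight w u \<le> weight w v))"
        proof
          assume *: "u \<in> keys (binom J1 J2) \<and> (\<forall>v\<in>keys (binom J1 J2). weight w u \<le> weight w v)"
          then have "u = ?n" using keys False by blast
          moreover have "weight w u \<le> weight w ?m" using * mk by blast
          ultimately show False using wt by simp
        qed
        then show ?thesis unfolding initial_form_lookup using False
          by (simp only: if_False lookup_single when_def) simp
      qed
    qed
    then show "x J1 * x J2 = 0" using ev by (simp add: eval_single del: One_nat_def)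
  }
qed

text \<open>Only initial terms supported on tight ideals survive at a point of the variety. If one
  of them has exponent \<open>v\<close>, then every term of \<open>f\<close> with exponent
  \<open>v\<close> is tight and initial too, so the coefficients still cancel fibre by
  fibre.\<close>

lemma hibi_variety_tight_subset:
  assumes le: "\<And>J. J \<in> V \<Longrightarrow> w J \<le> aff c J"
  shows "zero_set (tight c) (toric_ideal r' (tight c)) \<subseteq> zero_set V (initial_ideal w (toric_ideal r' V))"
proof
  interpret T: hibi_family P r' "tight c" using le by (rule tight_family)
  fix l assume "l \<in> zero_set (tight c) (toric_ideal r' (tight c))"
  then have l: "l \<in> T.hibi_variety" by (simp add: T.hibi_variety_def)
  have lV: "l \<in> proj_space V" using l T.hibi_variety_subset[OF tight_subset] by blast
  have "eval x (initial_form w f) = 0" if x: "x \<in> l" and f: "f \<in> toric_ideal r' V" for x f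
  proof -
    have xT: "x \<in> coord_space (tight c)" "T.quadric_zero x"
      using T.hibi_variety_iff[OF tight_subset lV] l x by auto
    let ?K = "{m \<in> keys f. \<forall>m'\<in>keys f. weight w m \<le> weight w m'}"
    let ?L = "{m \<in> ?K. keys m \<subseteq> tight c}"
    let ?\<mu> = "madd (hexp r')"
    have weight_le: "weight w m \<le> madd c (?\<mu> m)" if "m \<in> keys f" for m
    proof -
      have "keys m \<subseteq> V" using f that by (auto simp: polys_def)
      then show ?thesis unfolding weight_eq_madd madd_madd
        by (intro madd_mono le) auto
    qed
    have weight_less: "weight w m < madd c (?\<mu> m)" if m: "m \<in> keys f" "\<not> keys m \<subseteq> tight c" for m
    proof -
      obtain J where J: "J \<in> keys m" "J \<notin> tight c" using m(2) by blast
      have V: "keys m \<subseteq> V" using f m(1) by (auto simp: polys_def)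
      then have "w J < aff c J" using J le[of J] by (force simp: tight_def)
      then show ?thesis unfolding weight_eq_madd madd_madd
        using J(1) V le by (intro madd_strict_mono[of m _ _ J]) auto
    qed
    have weight_eq: "weight w m = madd c (?\<mu> m)" if "keys m \<subseteq> tight c" for m
      unfolding weight_eq_madd madd_madd using that by (intro madd_cong) (auto simp: tight_def)
    have "eval x (initial_form w f) = (\<Sum>m\<in>?K. lookup (initial_form w f) m * meval x m)"
      unfolding eval_eq keys_initial_form ..
    also have "\<dots> = (\<Sum>m\<in>?K. lookup f m * meval x m)"
      by (rule sum.cong) (simp_all add: initial_form_lookup)
    also have "\<dots> = (\<Sum>m\<in>?L. lookup f m * meval x m)"
    proof (rule sum.mono_neutral_right)
      show "\<forall>m\<in>?K - ?L. lookup f m * meval x m = 0"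
        using xT(1) by (auto simp: coord_space_def intro: meval_eq_0)
    qed auto
    also have "\<dots> = 0"
    proof (rule sum_fibres_zero)
      fix v
      show "(\<Sum>m | m \<in> ?L \<and> ?\<mu> m = v. lookup f m) = 0"
      proof (cases "{m. m \<in> ?L \<and> ?\<mu> m = v} = {}")
        case True
        then show ?thesis by (simp only: sum.empty)
      next
        case False
        then obtain n where n: "n \<in> ?L" "?\<mu> n = v" by blast
        \<comment> \<open>The weight of \<open>m\<close> is squeezed: it is at least that of the
          initial term \<open>n\<close>, which equals \<open>madd c v\<close>, and at most
          \<open>madd c v\<close>. A factor that is not tight would make the upper bound
          strict.\<close>
        have "m \<in> ?L" if m: "m \<in> keys f" "?\<mu> m = v" for m
        proof -
          have "weight w n = madd c v" using weight_eq[of n] n by simp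
          moreover have "weight w n \<le> weight w m" using n m(1) by simp
          ultimately have "\<not> weight w m < madd c (?\<mu> m)" "weight w m \<le> weight w n"
            using weight_le[OF m(1)] m(2) by auto
          then have "keys m \<subseteq> tight c" "weight w m \<le> weight w n" using weight_less[OF m(1)] by auto
          moreover have "weight w m \<le> weight w m'" if "m' \<in> keys f" for m'
          proof -
            have "weight w n \<le> weight w m'" using n(1) that by simp
            then show ?thesis using \<open>weight w m \<le> weight w n\<close> by simp
          qed
          ultimately show ?thesis using m(1) by simp
        qed
        then have "{m. m \<in> ?L \<and> ?\<mu> m = v} = {m. m \<in> keys f \<and> ?\<mu> m = v}" by blast
        then show ?thesis using f by (simp only: hibi_hom_eq_0_iff mem_Collect_eq)
      qed
    next
      show "meval x m = meval x m'" if "m \<in> ?L" "m' \<in> ?L" "?\<mu> m = ?\<mu> m'" for m m'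
        using that xT(2) by (intro T.quadric_zero_meval) auto
    qed simp
    finally show ?thesis .
  qed
  then have "\<forall>f\<in>initial_ideal w (toric_ideal r' V). eval x f = 0" if "x \<in> l" for x
    using that unfolding eval_initial_ideal_iff by blast
  then show "l \<in> zero_set V (initial_ideal w (toric_ideal r' V))"
    using lV by (simp add: zero_set_def)
qed

lemma initial_zero_set_cover:
  assumes flags: "\<And>D. D \<subseteq> V \<Longrightarrow> chain_subset D \<Longrightarrow> \<exists>F. D \<subseteq> F \<and> F \<subseteq> V \<and> flag P F"
    and l: "l \<in> zero_set V (initial_ideal w (toric_ideal r' V))"
  shows "\<exists>c F. (\<forall>J\<in>V. w J \<le> aff c J) \<and> flag P F \<and> F \<subseteq> tight c \<and>
    l \<in> zero_set (tight c) (toric_ideal r' (tight c))"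
proof -
  have lV: "l \<in> proj_space V" using l by (simp add: zero_set_def)
  then obtain x0 where x0: "l = proj_point x0" "x0 \<in> coord_space V" "x0 \<noteq> (\<lambda>v. 0)"
    by (auto simp: proj_space_def)
  have init: "\<forall>f\<in>toric_ideal r' V. eval x (initial_form w f) = 0" if "x \<in> l" for x
    using l that unfolding eval_initial_ideal_iff[symmetric] by (simp add: zero_set_def)
  define S where "S = {J. x0 J \<noteq> 0}"
  have "x0 \<in> l" unfolding x0(1) by (rule proj_point_self)
  note rel = binom_relations[OF init[OF this]]
  have SV: "S \<subseteq> V" using x0(2) by (auto simp: S_def coord_space_def)
  have S_ne: "S \<noteq> {}" using x0(3) by (auto simp: S_def)
  have S_closed: "J1 \<union> J2 \<in> S \<and> st J1 J2 \<in> S \<and> w J1 + w J2 = w (J1 \<union> J2) + w (st J1 J2)"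
    if J: "J1 \<in> S" "J2 \<in> S" for J1 J2
  proof -
    have JV: "J1 \<in> V" "J2 \<in> V" using J SV by auto
    \<comment> \<open>A strict weight inequality would force this product to vanish, so equality
      holds and the product equals that of the coordinates at the union and the star.\<close>
    have "x0 J1 * x0 J2 \<noteq> 0" using J by (simp add: S_def)
    then have eq: "w J1 + w J2 = w (J1 \<union> J2) + w (st J1 J2)"
      using rel(2)[OF JV] w_le[OF JV] by linarith
    then show ?thesis using rel(1)[OF JV] \<open>x0 J1 * x0 J2 \<noteq> 0\<close> by (simp add: S_def)
  qed
  have "finite V"
  proof (rule finite_subset)
    show "V \<subseteq> Pow P" using E_ideals ideal_subset by blast
  qed (simp add: finite_P)
  then have "finite S" using SV by (rule rev_finite_subset)
  then obtain D where D: "D \<subseteq> S" "chain_subset D"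
    and D_max: "\<forall>J\<in>S. (\<forall>A\<in>D. A \<subseteq> J \<or> J \<subseteq> A) \<longrightarrow> J \<in> D"
    using maximal_chain_extends[of S "{}"] by (auto simp: chain_subset_def)
  \<comment> \<open>The flag may leave the support \<open>S\<close>; interpolating \<open>w\<close>
    on it bounds \<open>w\<close> on all of \<open>V\<close>, while its part \<open>D\<close> makes
    all of \<open>S\<close> tight.\<close>
  obtain F where F: "D \<subseteq> F" "F \<subseteq> V" "flag P F"
    using flags[of D] D SV by blast
  have "F \<subseteq> ideals" using F(2) E_ideals by blast
  then obtain c where c: "\<forall>A\<in>F. aff c A = w A" using flag_affine F(3) by blast
  have le: "w J \<le> aff c J" if "J \<in> V" for J
    using w_le_affine[OF F(2,3) _ that] c by blast
  have FT: "F \<subseteq> tight c" using c F(2) by (auto simp: tight_def)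
  have ST: "S \<subseteq> tight c"
  proof (rule tight_supports[OF SV S_ne S_closed D])
    show "J \<in> D" if "J \<in> S" "\<And>A. A \<in> D \<Longrightarrow> A \<subseteq> J \<or> J \<subseteq> A" for J
      using bspec[OF D_max that(1)] that(2) by simp
    show "aff c A = w A" if "A \<in> D" for A using c F(1) that by blast
  qed
  interpret T: hibi_family P r' "tight c" using le by (rule tight_family)
  have "\<forall>x\<in>l. x \<in> coord_space (tight c) \<and> T.quadric_zero x"
  proof (intro ballI conjI)
    fix x assume x: "x \<in> l"
    then show "x \<in> coord_space (tight c)"
      using x0(1) ST by (auto simp: proj_point_def coord_space_def S_def)
    show "T.quadric_zero x" unfolding T.quadric_zero_def
    proof (intro ballI)
      fix J1 J2 assume J: "J1 \<in> tight c" "J2 \<in> tight c"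
      then have JV: "J1 \<in> V" "J2 \<in> V" using tight_subset by auto
      show "x J1 * x J2 = x (J1 \<union> J2) * x (st J1 J2)"
        using binom_relations(1)[OF init[OF x] JV] tight_closed[OF le J] by blast
    qed
  qed
  then have "l \<in> T.hibi_variety" using T.hibi_variety_iff[OF tight_subset lV] by simp
  then show ?thesis using le FT F(3) unfolding T.hibi_variety_def by blast
qed

text \<open>The varieties of tight families containing a flag are closed, irreducible and cover the
  zero set. A component lies in one of them and equals it by maximality.\<close>

lemma irreducible_component_tight:
  assumes flags: "\<And>D. D \<subseteq> V \<Longrightarrow> chain_subset D \<Longrightarrow> \<exists>F. D \<subseteq> F \<and> F \<subseteq> V \<and> flag P F"
    and Y: "irreducible_component V (zero_set V (initial_ideal w (toric_ideal r' V))) Y"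
  shows "\<exists>c F. (\<forall>J\<in>V. w J \<le> aff c J) \<and> flag P F \<and> F \<subseteq> tight c \<and>
    Y = zero_set (tight c) (toric_ideal r' (tight c))"
proof -
  let ?Z = "zero_set V (initial_ideal w (toric_ideal r' V))"
  define good where "good c \<longleftrightarrow> (\<forall>J\<in>V. w J \<le> aff c J) \<and> (\<exists>F. flag P F \<and> F \<subseteq> tight c)" for c
  let ?H = "\<lambda>E. zero_set E (toric_ideal r' E)"
  let ?C = "?H ` (tight ` Collect good)"
  have props: "zariski_closed V (?H (tight c))" "irreducible_subset V (?H (tight c))" "?H (tight c) \<subseteq> ?Z"
    if "good c" for c
  proof -
    have le: "w J \<le> aff c J" if "J \<in> V" for J using \<open>good c\<close> that by (simp add: good_def)
    interpret T: hibi_family P r' "tight c" using le by (rule tight_family)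
    have ne: "tight c \<noteq> {}" using \<open>good c\<close> by (auto simp: good_def flag_def)
    show "zariski_closed V (?H (tight c))"
      using T.zariski_closed_hibi_variety[OF tight_subset] by (simp add: T.hibi_variety_def)
    show "irreducible_subset V (?H (tight c))"
      using T.irreducible_hibi_variety[OF tight_subset ne] by (simp add: T.hibi_variety_def)
    show "?H (tight c) \<subseteq> ?Z" using le by (rule hibi_variety_tight_subset)
  qed
  have Y': "irreducible_subset V Y" "Y \<subseteq> ?Z"
    and Y_max: "\<And>Y'. irreducible_subset V Y' \<Longrightarrow> Y \<subseteq> Y' \<Longrightarrow> Y' \<subseteq> ?Z \<Longrightarrow> Y' = Y"
    using Y by (simp_all add: irreducible_component_def)
  have "\<exists>C\<in>?C. Y \<subseteq> C"
  proof (rule irreducible_subset_finite_cover[OF Y'(1)])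
    \<comment> \<open>There may be infinitely many functions \<open>c\<close>, but only finitely
      many families of subsets of \<open>P\<close>.\<close>
    have "tight ` Collect good \<subseteq> Pow (Pow P)"
      using tight_subset E_ideals ideal_subset by blast
    then have "finite (tight ` Collect good)" by (rule finite_subset) (simp add: finite_P)
    then show "finite ?C" by (rule finite_imageI)
    show "zariski_closed V C" if "C \<in> ?C" for C using that props(1) by auto
    show "Y \<subseteq> \<Union>?C"
    proof
      fix l assume "l \<in> Y"
      then have "l \<in> ?Z" using Y'(2) by blast
      from initial_zero_set_cover[OF flags this] obtain c where "good c" "l \<in> ?H (tight c)"
        unfolding good_def by blast
      then show "l \<in> \<Union>?C" by blast
    qed
  qed
  then obtain c where c: "good c" "Y \<subseteq> ?H (tight c)" by blast
  have "?H (tight c) = Y" using Y_max[OF props(2)[OF c(1)] c(2) props(3)[OF c(1)]] .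
  then show ?thesis using c(1) unfolding good_def by blast
qed

end

section \<open>Components as relative Hibi varieties\<close>

theorem theorem2p3p4:
  fixes P :: "'p set" and r r' :: "'p rel" and w :: "'p set \<Rightarrow> real"
    and Y :: "('p set \<Rightarrow> complex) set set"
  assumes "finite P"
    and "partial_order_on P r"
    and "partial_order_on P r'"
    and "weaker_order r' r"
    and "star_closed P r' (order_ideals P r)"
    and "w \<in> closure (initial_cone (order_ideals P r)
               (relative_hibi_ideal P r r') (monomial_hibi_ideal P r))"
    and "irreducible_component (order_ideals P r)
           (zero_set (order_ideals P r) (initial_ideal w (relative_hibi_ideal P r r'))) Y"
  shows "\<exists>r''. partial_order_on P r'' \<and> weaker_order r r'' \<and>
           star_closed P r' (order_ideals P r'') \<and>
           Y = relative_hibi_variety P r'' r'"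
proof -
  let ?V = "order_ideals P r"
  \<comment> \<open>Both orders are used: \<open>r\<close> supplies unions and flags inside \<J>,
    and \<open>r'\<close> supplies maximal elements and the star.\<close>
  interpret R: hibi_poset P r using assms(1,2) by unfold_locales
  interpret R': hibi_poset P r' using assms(1,3) by unfold_locales
  interpret V: hibi_family P r' ?V
  proof
    show "?V \<subseteq> R'.ideals" using assms(4) by (auto simp: order_ideals_def weaker_order_def)
    show "J1 \<union> J2 \<in> ?V" if "J1 \<in> ?V" "J2 \<in> ?V" for J1 J2 using that by (rule R.Un_ideal)
    show "star P r' J1 J2 \<in> ?V" if "J1 \<in> ?V" "J2 \<in> ?V" for J1 J2
      using assms(5) that by (simp add: star_closed_def)
  qed
  interpret W: weighted_hibi_family P r' ?V w
    using V.closure_initial_cone_le[OF assms(6)[unfolded relative_hibi_ideal_def]]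
    by unfold_locales
  obtain c F where le: "\<forall>J\<in>?V. w J \<le> W.aff c J" and F: "flag P F" "F \<subseteq> W.tight c"
    and Y: "Y = zero_set (W.tight c) (toric_ideal r' (W.tight c))"
    using W.irreducible_component_tight[OF R.chain_extends_to_flag
        assms(7)[unfolded relative_hibi_ideal_def]] by blast
  have le': "w J \<le> W.aff c J" if "J \<in> ?V" for J using le that by blast
  obtain r'' where r'': "partial_order_on P r''" "order_ideals P r'' = W.tight c"
    using W.tight_eq_order_ideals[OF le' F] by blast
  interpret T: hibi_family P r' "W.tight c" using le' by (rule W.tight_family)
  have "weaker_order r r''"
    unfolding weaker_order_def
  proof (intro allI impI)
    fix p q assume pq: "(p, q) \<in> r"
    \<comment> \<open>The principal ideal of \<open>q\<close> for \<open>r''\<close> is tight, hence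
      an order ideal for \<open>r\<close>; containing \<open>q\<close>, it must contain
      \<open>p\<close>.\<close>
    have "{s. (s, q) \<in> r''} \<in> order_ideals P r''"
      using partial_order_onD(2,4)[OF r''(1)] unfolding order_ideals_def trans_def by blast
    then have "{s. (s, q) \<in> r''} \<in> ?V" using r''(2) W.tight_subset by blast
    moreover have "(q, q) \<in> r''"
      using R.r'_field[OF pq] partial_order_onD(1)[OF r''(1)] by (simp add: refl_on_def)
    ultimately show "(p, q) \<in> r''" using R.ideal_down[OF _ _ pq] by blast
  qed
  moreover have "star_closed P r' (order_ideals P r'')"
    unfolding r''(2) star_closed_def using T.E_star by blast
  moreover have "Y = relative_hibi_variety P r'' r'"
    unfolding relative_hibi_variety_def relative_hibi_ideal_def r''(2) by (rule Y)
  ultimately show ?thesis using r''(1) by blast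
qed

end
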